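(* Let $m$ be a locally summable weight on a simplicial complex $\Sigma$. Then $F^+\subseteq D(\partial\delta)$, $F^-=D(\delta\partial)$, $F^+\cap F^-\subseteq D(\partial\delta+\delta\partial)$ and $$\mathcal H^+=\partial\delta\ \text{ on }F^+,\qquad \mathcal H^-=\delta\partial\ \text{ on }F^-=D(\delta\partial),\qquad \mathcal H^H=\partial\delta+\delta\partial\ \text{ on }F^+\cap F^-.$$ If the simplicial complex is locally finite, then equality holds on $F$. Furthermore, for $\eta\in F^c$, \begin{align*} \sum_\Sigma m(\mathcal H^+\omega)\eta&=\sum_\Sigma m(\delta\omega)(\delta\eta), &&\omega\in F^+,\\ \sum_\Sigma m(\mathcal H^-\omega)\eta&=\sum_\Sigma m(\partial\omega)(\partial\eta), &&\omega\in F^-=D(\delta\partial),\\ \sum_\Sigma m(\mathcal H^H\omega)\eta&=\sum_\Sigma m(\delta\omega)(\delta\eta)+\sum_\Sigma m(\partial\omega)(\partial\eta), &&\omega\in F^+\cap F^-. \end{align*}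
   Context: Simplicial complex: $V$ is a countable set and $\hat\Sigma$ is a collection of finite subsets of $V$ closed under taking subsets. $\dim\tau=|\tau|-1$, $\hat\Sigma_k=\{\tau\in\hat\Sigma:\dim\tau=k\}$. A weight is a function $m:\hat\Sigma\to(0,\infty)$. Put $\Sigma=\hat\Sigma$ if $\sum_{v\in\hat\Sigma_0}m(v)<\infty$, and $\Sigma=\hat\Sigma\setminus\{\varnothing\}$ otherwise; $\Sigma$ is then used in place of $\hat\Sigma$ and is also called the simplicial complex. The relation $\tau\prec\sigma$ (equivalently $\sigma\succ\tau$; $\sigma$ is a coface of $\tau$) means $\tau\subset\sigma$ and $|\sigma\setminus\tau|=1$, for $\tau,\sigma\in\Sigma$. All sums are over elements of $\Sigma$; $\sum_\Sigma f=\sum_{\sigma\in\Sigma}f(\sigma)$. The complex is locally finite if every simplex $\tau\neq\varnothing$ has only finitely many cofaces $\sigma\succ\tau$. The weight is locally summable if $\sum_{\sigma\succ\tau}m(\sigma)<\infty$ for all $\tau\in\Sigma$. Functions: $F=\mathbb{R}^{\Sigma}$; $F^c$ is the subspace of finitely supported functions; $F^1=\{\omega\in F:\sum_{\sigma\succ\tau}m(\sigma)|\omega(\sigma)|<\infty\text{ for all }\tau\in\Sigma\}$. Coboundary operator: a linear map $\delta:D(\delta)=F\to F$ with $\delta\delta=0$ such that $\theta(\tau,\sigma):=\delta 1_\tau(\sigma)\in\{-1,0,1\}$ and $\theta(\tau,\sigma)\neq0$ iff $\tau\prec\sigma$; it acts as $\delta\omega(\sigma)=\sum_{\tau\prec\sigma}\omega(\tau)\theta(\tau,\sigma)$.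 Boundary operator: $\partial:D(\partial)=F^1\to F$, $\partial\omega(\rho)=\frac1{m(\rho)}\sum_{\tau\succ\rho}m(\tau)\omega(\tau)\theta(\rho,\tau)$. Conventions: $D(A+B)=D(A)\cap D(B)$, $D(AB)=\{f\in D(B):Bf\in D(A)\}$. Signed Schrödinger operators: for $\tau,\tau'\in\Sigma$ let $b^+(\tau,\tau')=m(\tau\cup\tau')1_{\tau,\tau'\prec\tau\cup\tau'}$, $b^-(\tau,\tau')=\frac{m(\tau)m(\tau')}{m(\tau\cap\tau')}1_{\tau\cap\tau'\prec\tau,\tau'}$, $b^H(\tau,\tau')=|b^-(\tau,\tau')-b^+(\tau,\tau')|$ (all zero on the diagonal); $o^+(\tau,\tau')=-\theta(\tau,\tau\cup\tau')\theta(\tau',\tau\cup\tau')1_{\tau,\tau'\prec\tau\cup\tau'}$, $o^-(\tau,\tau')=-\theta(\tau\cap\tau',\tau)\theta(\tau\cap\tau',\tau')1_{\tau\cap\tau'\prec\tau,\tau'}$, $o^H(\tau,\tau')=o^-(\tau,\tau')\,\mathrm{sgn}(b^-(\tau,\tau')-b^+(\tau,\tau'))$; $$c^+(\tau)=-\dim(\tau)\sum_{\tau\prec\sigma}m(\sigma),\qquad c^-(\tau)=\sum_{\rho\prec\tau}\frac{m(\tau)}{m(\rho)}\Big(m(\tau)-\sum_{\rho\prec\tau'\neq\tau}m(\tau')\Big),$$ $$c^H(\tau)=\sum_{\rho\prec\tau}\frac{m^2(\tau)}{m(\rho)}+\sum_{\tau\prec\sigma}m(\sigma)-\sum_{\rho\prec\tau}\sum_{\rho\prec\tau'\neq\tau}\Big|\frac{m(\tau)m(\tau')}{m(\rho)}-\sum_{\tau,\tau'\prec\sigma}m(\sigma)\Big|.$$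 For $\circ\in\{+,-,H\}$, $F^\circ=\{\omega\in F:\sum_{\tau'\in\Sigma}b^\circ(\tau,\tau')|\omega(\tau')|<\infty\text{ for all }\tau\in\Sigma\}$ and $\mathcal H^\circ:F^\circ\to F$ is $$\mathcal H^\circ\omega(\tau)=\frac1{m(\tau)}\sum_{\tau'\in\Sigma}b^\circ(\tau,\tau')\big(\omega(\tau)-o^\circ(\tau,\tau')\omega(\tau')\big)+\frac{c^\circ(\tau)}{m(\tau)}\omega(\tau).$$
   Formalization: When ∅ is not in Σ, the H^H identity fails at vertices lying on an edge, so it is claimed only at the other simplices and η must vanish at those vertices; equality on F for H^- and H^H also requires that ∅, if in Σ, have finitely many cofaces. *)

theory Defs
  imports "HOL-Analysis.Infinite_Sum"
begin

definition simplicial_complex :: "'v set \<Rightarrow> 'v set set \<Rightarrow> bool" where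
  "simplicial_complex V K \<longleftrightarrow>
     countable V \<and> (\<forall>\<tau>\<in>K. finite \<tau> \<and> \<tau> \<subseteq> V) \<and> (\<forall>\<tau>\<in>K. \<forall>\<rho>. \<rho> \<subseteq> \<tau> \<longrightarrow> \<rho> \<in> K)"

definition sdim :: "'v set \<Rightarrow> int" where
  "sdim \<tau> = int (card \<tau>) - 1"

definition weight :: "'v set set \<Rightarrow> ('v set \<Rightarrow> real) \<Rightarrow> bool" where
  "weight K m \<longleftrightarrow> (\<forall>\<tau>\<in>K. m \<tau> > 0)"

text \<open>The complex one actually works with: the empty simplex is discarded
  if the vertices have infinite total weight.\<close>

definition working_complex :: "'v set set \<Rightarrow> ('v set \<Rightarrow> real) \<Rightarrow> 'v set set" where
  "working_complex K m = (if m summable_on {\<tau>\<in>K. sdim \<tau> = 0} then K else K - {{}})"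

text \<open>Everything below is relative to the working complex \<open>S\<close>; in particular both
  sides of the coface relation are required to lie in \<open>S\<close>.\<close>

definition coface :: "'v set set \<Rightarrow> 'v set \<Rightarrow> 'v set \<Rightarrow> bool" where
  "coface S \<tau> \<sigma> \<longleftrightarrow> \<tau> \<in> S \<and> \<sigma> \<in> S \<and> \<tau> \<subset> \<sigma> \<and> card (\<sigma> - \<tau>) = 1"

definition cofaces :: "'v set set \<Rightarrow> 'v set \<Rightarrow> 'v set set" where
  "cofaces S \<tau> = {\<sigma>. coface S \<tau> \<sigma>}"

definition faces :: "'v set set \<Rightarrow> 'v set \<Rightarrow> 'v set set" where
  "faces S \<sigma> = {\<tau>. coface S \<tau> \<sigma>}"

text \<open>Finiteness is only asked of nonempty simplices: the empty simplex, if present, may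
  have infinitely many vertices as cofaces.\<close>

definition locally_finite :: "'v set set \<Rightarrow> bool" where
  "locally_finite S \<longleftrightarrow> (\<forall>\<tau>\<in>S. \<tau> \<noteq> {} \<longrightarrow> finite (cofaces S \<tau>))"

definition locally_summable :: "'v set set \<Rightarrow> ('v set \<Rightarrow> real) \<Rightarrow> bool" where
  "locally_summable S m \<longleftrightarrow> (\<forall>\<tau>\<in>S. m summable_on cofaces S \<tau>)"

text \<open>A real function on \<open>S\<close> is represented by its extension by \<open>0\<close>, so that
  equality of functions on \<open>S\<close> is equality in HOL.\<close>

definition F :: "'v set set \<Rightarrow> ('v set \<Rightarrow> real) set" where
  "F S = {\<omega>. \<forall>\<tau>. \<tau> \<notin> S \<longrightarrow> \<omega> \<tau> = 0}"

definition Fc :: "'v set set \<Rightarrow> ('v set \<Rightarrow> real) set" where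
  "Fc S = {\<omega>\<in>F S. finite {\<tau>. \<omega> \<tau> \<noteq> 0}}"

definition F1 :: "'v set set \<Rightarrow> ('v set \<Rightarrow> real) \<Rightarrow> ('v set \<Rightarrow> real) set" where
  "F1 S m = {\<omega>\<in>F S. \<forall>\<tau>\<in>S. (\<lambda>\<sigma>. m \<sigma> * \<bar>\<omega> \<sigma>\<bar>) summable_on cofaces S \<tau>}"

text \<open>Operators come with their domain; values outside the domain are irrelevant.\<close>

datatype 'v operator =
  Operator (odom: "('v set \<Rightarrow> real) set") (oapp: "('v set \<Rightarrow> real) \<Rightarrow> ('v set \<Rightarrow> real)")

definition op_add :: "'v operator \<Rightarrow> 'v operator \<Rightarrow> 'v operator" where
  "op_add A B = Operator (odom A \<inter> odom B) (\<lambda>\<omega> \<tau>. oapp A \<omega> \<tau> + oapp B \<omega> \<tau>)"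

definition op_mult :: "'v operator \<Rightarrow> 'v operator \<Rightarrow> 'v operator" where
  "op_mult A B = Operator {\<omega>\<in>odom B. oapp B \<omega> \<in> odom A} (\<lambda>\<omega>. oapp A (oapp B \<omega>))"

text \<open>\<open>A = B\<close> on the set of functions \<open>D\<close>, evaluated at the simplices in \<open>X\<close>.  This
  includes that both operators are defined on \<open>D\<close>.\<close>

definition agree_on ::
  "('v set \<Rightarrow> real) set \<Rightarrow> 'v set set \<Rightarrow> 'v operator \<Rightarrow> 'v operator \<Rightarrow> bool" where
  "agree_on D X A B \<longleftrightarrow>
     D \<subseteq> odom A \<and> D \<subseteq> odom B \<and> (\<forall>\<omega>\<in>D. \<forall>\<tau>\<in>X. oapp A \<omega> \<tau> = oapp B \<omega> \<tau>)"

definition theta ::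
  "(('v set \<Rightarrow> real) \<Rightarrow> ('v set \<Rightarrow> real)) \<Rightarrow> 'v set \<Rightarrow> 'v set \<Rightarrow> real" where
  "theta d \<tau> \<sigma> = d (indicator {\<tau>}) \<sigma>"

definition coboundary ::
  "'v set set \<Rightarrow> (('v set \<Rightarrow> real) \<Rightarrow> ('v set \<Rightarrow> real)) \<Rightarrow> bool" where
  "coboundary S d \<longleftrightarrow>
     (\<forall>\<omega>\<in>F S. d \<omega> \<in> F S) \<and>
     (\<forall>\<omega>\<in>F S. \<forall>\<eta>\<in>F S. \<forall>a b. d (\<lambda>\<sigma>. a * \<omega> \<sigma> + b * \<eta> \<sigma>) = (\<lambda>\<sigma>. a * d \<omega> \<sigma> + b * d \<eta> \<sigma>)) \<and>
     (\<forall>\<omega>\<in>F S. d (d \<omega>) = (\<lambda>_. 0)) \<and>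
     (\<forall>\<tau>\<in>S. \<forall>\<sigma>\<in>S. theta d \<tau> \<sigma> \<in> {-1, 0, 1} \<and> (theta d \<tau> \<sigma> \<noteq> 0 \<longleftrightarrow> coface S \<tau> \<sigma>)) \<and>
     (\<forall>\<omega>\<in>F S. \<forall>\<sigma>\<in>S. d \<omega> \<sigma> = (\<Sum>\<tau>\<in>faces S \<sigma>. \<omega> \<tau> * theta d \<tau> \<sigma>))"

definition coboundary_op ::
  "'v set set \<Rightarrow> (('v set \<Rightarrow> real) \<Rightarrow> ('v set \<Rightarrow> real)) \<Rightarrow> 'v operator" where
  "coboundary_op S d = Operator (F S) d"

definition boundary_op ::
  "'v set set \<Rightarrow> ('v set \<Rightarrow> real) \<Rightarrow> (('v set \<Rightarrow> real) \<Rightarrow> ('v set \<Rightarrow> real)) \<Rightarrow> 'v operator" where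
  "boundary_op S m d = Operator (F1 S m)
     (\<lambda>\<omega> \<rho>. if \<rho> \<in> S
            then 1 / m \<rho> * (\<Sum>\<^sub>\<infinity>\<tau>\<in>cofaces S \<rho>. m \<tau> * \<omega> \<tau> * theta d \<rho> \<tau>)
            else 0)"

definition b_plus :: "'v set set \<Rightarrow> ('v set \<Rightarrow> real) \<Rightarrow> 'v set \<Rightarrow> 'v set \<Rightarrow> real" where
  "b_plus S m \<tau> \<tau>' =
     (if coface S \<tau> (\<tau> \<union> \<tau>') \<and> coface S \<tau>' (\<tau> \<union> \<tau>') then m (\<tau> \<union> \<tau>') else 0)"

definition b_minus :: "'v set set \<Rightarrow> ('v set \<Rightarrow> real) \<Rightarrow> 'v set \<Rightarrow> 'v set \<Rightarrow> real" where
  "b_minus S m \<tau> \<tau>' =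
     (if coface S (\<tau> \<inter> \<tau>') \<tau> \<and> coface S (\<tau> \<inter> \<tau>') \<tau>' then m \<tau> * m \<tau>' / m (\<tau> \<inter> \<tau>') else 0)"

definition b_H :: "'v set set \<Rightarrow> ('v set \<Rightarrow> real) \<Rightarrow> 'v set \<Rightarrow> 'v set \<Rightarrow> real" where
  "b_H S m \<tau> \<tau>' = \<bar>b_minus S m \<tau> \<tau>' - b_plus S m \<tau> \<tau>'\<bar>"

definition o_plus ::
  "'v set set \<Rightarrow> (('v set \<Rightarrow> real) \<Rightarrow> ('v set \<Rightarrow> real)) \<Rightarrow> 'v set \<Rightarrow> 'v set \<Rightarrow> real" where
  "o_plus S d \<tau> \<tau>' =
     (if coface S \<tau> (\<tau> \<union> \<tau>') \<and> coface S \<tau>' (\<tau> \<union> \<tau>')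
      then - theta d \<tau> (\<tau> \<union> \<tau>') * theta d \<tau>' (\<tau> \<union> \<tau>') else 0)"

definition o_minus ::
  "'v set set \<Rightarrow> (('v set \<Rightarrow> real) \<Rightarrow> ('v set \<Rightarrow> real)) \<Rightarrow> 'v set \<Rightarrow> 'v set \<Rightarrow> real" where
  "o_minus S d \<tau> \<tau>' =
     (if coface S (\<tau> \<inter> \<tau>') \<tau> \<and> coface S (\<tau> \<inter> \<tau>') \<tau>'
      then - theta d (\<tau> \<inter> \<tau>') \<tau> * theta d (\<tau> \<inter> \<tau>') \<tau>' else 0)"

definition o_H ::
  "'v set set \<Rightarrow> ('v set \<Rightarrow> real) \<Rightarrow> (('v set \<Rightarrow> real) \<Rightarrow> ('v set \<Rightarrow> real)) \<Rightarrow>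
   'v set \<Rightarrow> 'v set \<Rightarrow> real" where
  "o_H S m d \<tau> \<tau>' = o_minus S d \<tau> \<tau>' * sgn (b_minus S m \<tau> \<tau>' - b_plus S m \<tau> \<tau>')"

definition c_plus :: "'v set set \<Rightarrow> ('v set \<Rightarrow> real) \<Rightarrow> 'v set \<Rightarrow> real" where
  "c_plus S m \<tau> = - of_int (sdim \<tau>) * (\<Sum>\<^sub>\<infinity>\<sigma>\<in>cofaces S \<tau>. m \<sigma>)"

definition c_minus :: "'v set set \<Rightarrow> ('v set \<Rightarrow> real) \<Rightarrow> 'v set \<Rightarrow> real" where
  "c_minus S m \<tau> =
     (\<Sum>\<rho>\<in>faces S \<tau>. m \<tau> / m \<rho> * (m \<tau> - (\<Sum>\<^sub>\<infinity>\<tau>'\<in>cofaces S \<rho> - {\<tau>}. m \<tau>')))"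

definition c_H :: "'v set set \<Rightarrow> ('v set \<Rightarrow> real) \<Rightarrow> 'v set \<Rightarrow> real" where
  "c_H S m \<tau> =
     (\<Sum>\<rho>\<in>faces S \<tau>. (m \<tau>)\<^sup>2 / m \<rho>) + (\<Sum>\<^sub>\<infinity>\<sigma>\<in>cofaces S \<tau>. m \<sigma>)
     - (\<Sum>\<rho>\<in>faces S \<tau>. \<Sum>\<^sub>\<infinity>\<tau>'\<in>cofaces S \<rho> - {\<tau>}.
          \<bar>m \<tau> * m \<tau>' / m \<rho> - (\<Sum>\<^sub>\<infinity>\<sigma>\<in>cofaces S \<tau> \<inter> cofaces S \<tau>'. m \<sigma>)\<bar>)"

text \<open>The signed Schroedinger operator with edge weight \<open>b\<close>, signature \<open>s\<close>
  and potential \<open>c\<close>, on its maximal domain.\<close>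

definition schroedinger_op ::
  "'v set set \<Rightarrow> ('v set \<Rightarrow> real) \<Rightarrow> ('v set \<Rightarrow> 'v set \<Rightarrow> real) \<Rightarrow>
   ('v set \<Rightarrow> 'v set \<Rightarrow> real) \<Rightarrow> ('v set \<Rightarrow> real) \<Rightarrow> 'v operator" where
  "schroedinger_op S m b s c = Operator
     {\<omega>\<in>F S. \<forall>\<tau>\<in>S. (\<lambda>\<tau>'. b \<tau> \<tau>' * \<bar>\<omega> \<tau>'\<bar>) summable_on S}
     (\<lambda>\<omega> \<tau>. if \<tau> \<in> S
            then 1 / m \<tau> * (\<Sum>\<^sub>\<infinity>\<tau>'\<in>S. b \<tau> \<tau>' * (\<omega> \<tau> - s \<tau> \<tau>' * \<omega> \<tau>')) + c \<tau> / m \<tau> * \<omega> \<tau>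
            else 0)"

definition H_plus ::
  "'v set set \<Rightarrow> ('v set \<Rightarrow> real) \<Rightarrow> (('v set \<Rightarrow> real) \<Rightarrow> ('v set \<Rightarrow> real)) \<Rightarrow> 'v operator" where
  "H_plus S m d = schroedinger_op S m (b_plus S m) (o_plus S d) (c_plus S m)"

definition H_minus ::
  "'v set set \<Rightarrow> ('v set \<Rightarrow> real) \<Rightarrow> (('v set \<Rightarrow> real) \<Rightarrow> ('v set \<Rightarrow> real)) \<Rightarrow> 'v operator" where
  "H_minus S m d = schroedinger_op S m (b_minus S m) (o_minus S d) (c_minus S m)"

definition H_H ::
  "'v set set \<Rightarrow> ('v set \<Rightarrow> real) \<Rightarrow> (('v set \<Rightarrow> real) \<Rightarrow> ('v set \<Rightarrow> real)) \<Rightarrow> 'v operator" where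
  "H_H S m d = schroedinger_op S m (b_H S m) (o_H S m d) (c_H S m)"

text \<open>The simplices at which \<open>b_H\<close>, \<open>o_H\<close> and \<open>c_H\<close> describe the Hodge Laplacian.
  The only exceptions are the non-isolated vertices when the empty simplex has been discarded:
  for the endpoints \<open>\<tau>\<close>, \<open>\<tau>'\<close> of an edge one then has \<open>o_minus S d \<tau> \<tau>' = 0\<close>, because
  the common face \<open>\<tau> \<inter> \<tau>' = {}\<close> is missing, hence \<open>o_H S m d \<tau> \<tau>' = 0\<close>, although
  \<open>b_H S m \<tau> \<tau>' = m (\<tau> \<union> \<tau>') > 0\<close>.
  If \<open>{} \<in> S\<close>, then \<open>regular_simplices S = S\<close>.\<close>

definition regular_simplices :: "'v set set \<Rightarrow> 'v set set" where
  "regular_simplices S = {\<tau>\<in>S. {} \<in> S \<or> sdim \<tau> \<noteq> 0 \<or> cofaces S \<tau> = {}}"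

definition pairable ::
  "'v set set \<Rightarrow> ('v set \<Rightarrow> real) \<Rightarrow> ('v set \<Rightarrow> real) \<Rightarrow> ('v set \<Rightarrow> real) \<Rightarrow> bool" where
  "pairable S m f g \<longleftrightarrow> (\<lambda>\<sigma>. m \<sigma> * f \<sigma> * g \<sigma>) summable_on S"

definition pairing ::
  "'v set set \<Rightarrow> ('v set \<Rightarrow> real) \<Rightarrow> ('v set \<Rightarrow> real) \<Rightarrow> ('v set \<Rightarrow> real) \<Rightarrow> real" where
  "pairing S m f g = (\<Sum>\<^sub>\<infinity>\<sigma>\<in>S. m \<sigma> * f \<sigma> * g \<sigma>)"

end

theory Submission
  imports Defs
begin

text \<open>
  Writing out \<open>\<partial>\<delta>\<omega>(\<tau>)\<close> gives a sum over pairs \<open>\<tau> \<prec> \<sigma> \<succ> \<tau>'\<close>, and \<open>\<delta>\<partial>\<omega>(\<tau>)\<close> one over pairs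
  \<open>\<tau> \<succ> \<rho> \<prec> \<tau>'\<close>. For \<open>\<tau>' \<noteq> \<tau>\<close> the middle simplex is determined as \<open>\<sigma> = \<tau> \<union> \<tau>'\<close>, respectively
  \<open>\<rho> = \<tau> \<inter> \<tau>'\<close>, so these are sums over \<open>\<tau>'\<close> weighted by \<open>b\<^sup>+\<close>, respectively \<open>b\<^sup>-\<close>.
  Local summability and the domain conditions allow the diagonal terms to be separated, and each
  potential \<open>c\<close> is the coefficient of the diagonal term minus the total edge weight at \<open>\<tau>\<close>.
  If \<open>\<tau>\<close> and \<open>\<tau>'\<close> have both a common coface and a common face, \<open>\<delta>\<delta> = 0\<close> forces
  \<open>o\<^sup>- = - o\<^sup>+\<close>, so \<open>b\<^sup>H o\<^sup>H = b\<^sup>- o\<^sup>- + b\<^sup>+ o\<^sup>+\<close>. The pairing formulas follow by exchanging the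
  order of summation over the pairs \<open>\<tau> \<prec> \<sigma>\<close>.
\<close>

section \<open>Unconditional sums: comparison, finite disjoint unions, finite support\<close>

lemma summable_on_real_comparison:
  fixes f g :: "'a \<Rightarrow> real"
  assumes "g summable_on A" and "\<And>x. x \<in> A \<Longrightarrow> \<bar>f x\<bar> \<le> g x"
  shows "f summable_on A"
  unfolding summable_on_iff_abs_summable_on_real[of f]
  by (rule abs_summable_on_comparison_test') (use assms in auto)

lemma has_sum_UN_disjoint:
  fixes f :: "'a \<Rightarrow> 'b::topological_comm_monoid_add"
  assumes "finite I" and "\<And>i. i \<in> I \<Longrightarrow> (f has_sum h i) (A i)" and "disjoint_family_on A I"
  shows "(f has_sum sum h I) (\<Union>i\<in>I. A i)"
  using assms
proof (induction rule: finite_induct)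
  case (insert i I)
  have disj: "A i \<inter> (\<Union>j\<in>I. A j) = {}" "disjoint_family_on A I"
    using insert.prems(2) disjoint_family_on_insert[OF insert.hyps(2)] by metis+
  have "(f has_sum h i + sum h I) (A i \<union> (\<Union>j\<in>I. A j))"
    by (rule has_sum_Un_disjoint[OF insert.prems(1) insert.IH[OF insert.prems(1) disj(2)] disj(1)])
      simp_all
  then show ?case
    using insert.hyps by simp
qed simp

lemma summable_on_finite_support:
  assumes "finite {x\<in>A. f x \<noteq> 0}"
  shows "f summable_on A"
proof (rule has_sum_imp_summable)
  show "(f has_sum sum f {x\<in>A. f x \<noteq> 0}) A"
    by (rule has_sum_finite_neutralI[OF assms]) auto
qed

text \<open>The domains are given by conditions on absolute values; this turns such a condition into
  convergence of the series with signs, be they \<open>o_plus\<close>, \<open>o_minus\<close> or the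
  incidence numbers \<open>\<theta>\<close>.\<close>

lemma summable_signed:
  fixes b s \<omega> :: "'a \<Rightarrow> real"
  assumes "(\<lambda>x. b x * \<bar>\<omega> x\<bar>) summable_on A"
    and "\<And>x. x \<in> A \<Longrightarrow> 0 \<le> b x" "\<And>x. x \<in> A \<Longrightarrow> \<bar>s x\<bar> \<le> 1"
  shows "(\<lambda>x. b x * s x * \<omega> x) summable_on A"
  using assms(1)
proof (rule summable_on_real_comparison)
  fix x assume "x \<in> A"
  then have "b x * \<bar>\<omega> x\<bar> * \<bar>s x\<bar> \<le> b x * \<bar>\<omega> x\<bar> * 1"
    using assms(2,3) by (intro mult_left_mono) auto
  then show "\<bar>b x * s x * \<omega> x\<bar> \<le> b x * \<bar>\<omega> x\<bar>"
    using assms(2) \<open>x \<in> A\<close> by (simp add: abs_mult mult_ac)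
qed

section \<open>The coface relation\<close>

lemma coface_iff: "coface S \<tau> \<sigma> \<longleftrightarrow> \<tau> \<in> S \<and> \<sigma> \<in> S \<and> (\<exists>v. v \<notin> \<tau> \<and> \<sigma> = insert v \<tau>)"
proof -
  have "\<tau> \<subset> \<sigma> \<and> card (\<sigma> - \<tau>) = 1 \<longleftrightarrow> (\<exists>v. v \<notin> \<tau> \<and> \<sigma> = insert v \<tau>)"
  proof
    assume *: "\<tau> \<subset> \<sigma> \<and> card (\<sigma> - \<tau>) = 1"
    then obtain v where "\<sigma> - \<tau> = {v}"
      using card_1_singletonE by blast
    with * show "\<exists>v. v \<notin> \<tau> \<and> \<sigma> = insert v \<tau>"
      by blast
  next
    assume "\<exists>v. v \<notin> \<tau> \<and> \<sigma> = insert v \<tau>"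
    then obtain v where v: "v \<notin> \<tau>" "\<sigma> = insert v \<tau>"
      by blast
    then have "\<sigma> - \<tau> = {v}"
      by blast
    with v show "\<tau> \<subset> \<sigma> \<and> card (\<sigma> - \<tau>) = 1"
      by auto
  qed
  then show ?thesis
    unfolding coface_def by blast
qed

lemma mem_faces [simp]: "\<tau> \<in> faces S \<sigma> \<longleftrightarrow> coface S \<tau> \<sigma>"
  and mem_cofaces [simp]: "\<sigma> \<in> cofaces S \<tau> \<longleftrightarrow> coface S \<tau> \<sigma>"
  by (auto simp: faces_def cofaces_def)

lemma not_coface_self [simp]: "\<not> coface S \<tau> \<tau>"
  by (simp add: coface_def)

lemma coface_inD: "coface S \<tau> \<sigma> \<Longrightarrow> \<tau> \<in> S" "coface S \<tau> \<sigma> \<Longrightarrow> \<sigma> \<in> S"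
  by (auto simp: coface_def)

text \<open>The vertices missing from \<tau> and from \<tau>' differ, so each of them lies in the
  other face. Two distinct simplices thus have at most one common coface.\<close>

lemma coface_Un_eq:
  assumes "coface S \<tau> \<sigma>" "coface S \<tau>' \<sigma>" "\<tau> \<noteq> \<tau>'"
  shows "\<tau> \<union> \<tau>' = \<sigma>"
proof -
  obtain v w where v: "v \<notin> \<tau>" "\<sigma> = insert v \<tau>" and w: "w \<notin> \<tau>'" "\<sigma> = insert w \<tau>'"
    using assms by (auto simp: coface_iff)
  then have "v \<noteq> w"
    using assms(3) by (metis Diff_insert_absorb)
  then show ?thesis
    using v w by blast
qed

lemma coface_Int_eq:
  assumes "coface S \<rho> \<tau>" "coface S \<rho> \<tau>'" "\<tau> \<noteq> \<tau>'"
  shows "\<tau> \<inter> \<tau>' = \<rho>"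
proof -
  obtain v w where v: "v \<notin> \<rho>" "\<tau> = insert v \<rho>" and w: "w \<notin> \<rho>" "\<tau>' = insert w \<rho>"
    using assms unfolding coface_iff by blast
  then have "v \<noteq> w"
    using assms(3) by blast
  then show ?thesis
    using v w by blast
qed

lemma oapp_op_mult: "oapp (op_mult A B) \<omega> = oapp A (oapp B \<omega>)"
  and oapp_op_add: "oapp (op_add A B) \<omega> \<tau> = oapp A \<omega> \<tau> + oapp B \<omega> \<tau>"
  by (simp_all add: op_mult_def op_add_def)

section \<open>Signed complexes and their coboundary\<close>

text \<open>Closure is asked of nonempty faces only, so the same arguments cover the working complex
  with and without the empty simplex.\<close>

locale signed_complex =
  fixes S :: "'v set set" and m :: "'v set \<Rightarrow> real"
    and d :: "('v set \<Rightarrow> real) \<Rightarrow> ('v set \<Rightarrow> real)"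
  assumes finite_simplex: "\<tau> \<in> S \<Longrightarrow> finite \<tau>"
    and nonempty_face: "\<sigma> \<in> S \<Longrightarrow> \<rho> \<subseteq> \<sigma> \<Longrightarrow> \<rho> \<noteq> {} \<Longrightarrow> \<rho> \<in> S"
    and weight_pos: "\<tau> \<in> S \<Longrightarrow> 0 < m \<tau>"
    and locally_summable: "locally_summable S m"
    and coboundary: "coboundary S d"
begin

abbreviation bp where "bp \<equiv> b_plus S m"
abbreviation bm where "bm \<equiv> b_minus S m"
abbreviation op where "op \<equiv> o_plus S d"
abbreviation om where "om \<equiv> o_minus S d"
abbreviation \<theta> where "\<theta> \<equiv> theta d"

lemma coface_pos: "coface S \<tau> \<sigma> \<Longrightarrow> 0 < m \<tau>" "coface S \<tau> \<sigma> \<Longrightarrow> 0 < m \<sigma>"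
  using weight_pos coface_inD by metis+

lemma finite_faces: "\<sigma> \<in> S \<Longrightarrow> finite (faces S \<sigma>)"
  by (rule finite_subset[of _ "Pow \<sigma>"]) (auto simp: coface_def finite_simplex)

lemma theta_cases: "coface S \<tau> \<sigma> \<Longrightarrow> \<theta> \<tau> \<sigma> = 1 \<or> \<theta> \<tau> \<sigma> = -1"
  using coboundary coface_inD[of S \<tau> \<sigma>] unfolding coboundary_def by blast

lemma theta_eq_0: "\<tau> \<in> S \<Longrightarrow> \<sigma> \<in> S \<Longrightarrow> \<not> coface S \<tau> \<sigma> \<Longrightarrow> \<theta> \<tau> \<sigma> = 0"
  using coboundary unfolding coboundary_def by blast

lemma theta_square: "coface S \<tau> \<sigma> \<Longrightarrow> \<theta> \<tau> \<sigma> * \<theta> \<tau> \<sigma> = 1"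
  and abs_theta: "coface S \<tau> \<sigma> \<Longrightarrow> \<bar>\<theta> \<tau> \<sigma>\<bar> = 1"
  by (auto dest: theta_cases)

lemma coboundary_in_F: "\<omega> \<in> F S \<Longrightarrow> d \<omega> \<in> F S"
  and coboundary_coboundary: "\<omega> \<in> F S \<Longrightarrow> d (d \<omega>) = (\<lambda>_. 0)"
  and coboundary_apply:
    "\<omega> \<in> F S \<Longrightarrow> \<sigma> \<in> S \<Longrightarrow> d \<omega> \<sigma> = (\<Sum>\<tau>\<in>faces S \<sigma>. \<omega> \<tau> * \<theta> \<tau> \<sigma>)"
  using coboundary unfolding coboundary_def by blast+

lemma summable_cofaces: "\<tau> \<in> S \<Longrightarrow> m summable_on cofaces S \<tau>"
  using locally_summable unfolding locally_summable_def by blast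

section \<open>Neighbours through a common coface or a common face\<close>

lemma plus_cofaces:
  assumes "coface S \<tau> \<sigma>" "coface S \<tau>' \<sigma>" "\<tau>' \<noteq> \<tau>"
  shows "bp \<tau> \<tau>' = m \<sigma>" "op \<tau> \<tau>' = - \<theta> \<tau> \<sigma> * \<theta> \<tau>' \<sigma>"
proof -
  have "\<tau> \<union> \<tau>' = \<sigma>"
    using coface_Un_eq assms by metis
  then show "bp \<tau> \<tau>' = m \<sigma>" "op \<tau> \<tau>' = - \<theta> \<tau> \<sigma> * \<theta> \<tau>' \<sigma>"
    using assms by (simp_all add: b_plus_def o_plus_def)
qed

lemma minus_cofaces:
  assumes "coface S \<rho> \<tau>" "coface S \<rho> \<tau>'" "\<tau>' \<noteq> \<tau>"
  shows "bm \<tau> \<tau>' = m \<tau> * m \<tau>' / m \<rho>" "om \<tau> \<tau>' = - \<theta> \<rho> \<tau> * \<theta> \<rho> \<tau>'"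
proof -
  have "\<tau> \<inter> \<tau>' = \<rho>"
    using coface_Int_eq assms by metis
  then show "bm \<tau> \<tau>' = m \<tau> * m \<tau>' / m \<rho>" "om \<tau> \<tau>' = - \<theta> \<rho> \<tau> * \<theta> \<rho> \<tau>'"
    using assms by (simp_all add: b_minus_def o_minus_def)
qed

lemma b_plus_nonzeroD:
  "bp \<tau> \<tau>' \<noteq> 0 \<Longrightarrow> coface S \<tau> (\<tau> \<union> \<tau>') \<and> coface S \<tau>' (\<tau> \<union> \<tau>') \<and> \<tau>' \<noteq> \<tau>"
  by (cases "\<tau>' = \<tau>") (simp_all add: b_plus_def split: if_splits)

lemma b_minus_nonzeroD:
  "bm \<tau> \<tau>' \<noteq> 0 \<Longrightarrow> coface S (\<tau> \<inter> \<tau>') \<tau> \<and> coface S (\<tau> \<inter> \<tau>') \<tau>' \<and> \<tau>' \<noteq> \<tau>"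
  by (cases "\<tau>' = \<tau>") (simp_all add: b_minus_def split: if_splits)

lemma b_plus_nonneg: "0 \<le> bp \<tau> \<tau>'" and b_minus_nonneg: "0 \<le> bm \<tau> \<tau>'"
  using coface_pos(1)[of "\<tau> \<inter> \<tau>'" \<tau>] coface_pos(2)[of "\<tau> \<inter> \<tau>'" \<tau>]
    coface_pos(2)[of "\<tau> \<inter> \<tau>'" \<tau>'] coface_pos(2)[of \<tau> "\<tau> \<union> \<tau>'"]
  by (simp_all add: b_plus_def b_minus_def less_imp_le)

lemma abs_o_plus_le: "\<bar>op \<tau> \<tau>'\<bar> \<le> 1" and abs_o_minus_le: "\<bar>om \<tau> \<tau>'\<bar> \<le> 1"
  by (auto simp: o_plus_def o_minus_def abs_mult abs_theta)

text \<open>As \<sigma> = \<tau> \<union> \<tau>' is determined by \<tau>', the projection of the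
  pairs (\<sigma>, \<tau>') to \<tau>' is injective, and its image contains the support of
  \<open>bp \<tau>\<close>. One direction serves to prove summability over \<open>S\<close>, the
  other to regroup a sum over \<open>S\<close> by cofaces.\<close>

lemma has_sum_upper_neighbours:
  assumes "\<And>\<tau>'. bp \<tau> \<tau>' = 0 \<Longrightarrow> g \<tau>' = 0"
  shows "(g has_sum x) S \<longleftrightarrow>
    ((\<lambda>(\<sigma>, \<tau>'). g \<tau>') has_sum x) (SIGMA \<sigma>:cofaces S \<tau>. faces S \<sigma> - {\<tau>})" (is "_ \<longleftrightarrow> (_ has_sum x) ?U")
proof -
  have "inj_on snd ?U"
  proof (rule inj_onI)
    fix p q assume "p \<in> ?U" "q \<in> ?U" "snd p = snd q"
    then show "p = q"
      using coface_Un_eq[of S \<tau> _ "snd p"] by (metis (no_types, lifting) DiffE SigmaE mem_cofaces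
          mem_faces prod.sel(2) singletonI)
  qed
  then have "((\<lambda>(\<sigma>, \<tau>'). g \<tau>') has_sum x) ?U \<longleftrightarrow> (g has_sum x) (snd ` ?U)"
    by (simp add: has_sum_reindex o_def case_prod_unfold)
  also have "\<dots> \<longleftrightarrow> (g has_sum x) S"
  proof (rule has_sum_cong_neutral)
    fix \<tau>' assume *: "\<tau>' \<in> S - snd ` ?U"
    have "bp \<tau> \<tau>' = 0"
    proof (rule ccontr)
      assume "bp \<tau> \<tau>' \<noteq> 0"
      from b_plus_nonzeroD[OF this] have "(\<tau> \<union> \<tau>', \<tau>') \<in> ?U"
        by simp
      with * show False
        by force
    qed
    then show "g \<tau>' = 0"
      by (rule assms)
  qed (auto dest: coface_inD)
  finally show ?thesis
    by simp
qed

text \<open>The pairs are summed first over \<tau>' and then over \<sigma>; the inner sums are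
  finite because a simplex has finitely many faces.\<close>

lemma has_sum_over_cofaces:
  fixes g :: "'v set \<Rightarrow> real"
  assumes "\<And>\<tau>'. bp \<tau> \<tau>' = 0 \<Longrightarrow> g \<tau>' = 0" and "g summable_on S"
  shows "((\<lambda>\<sigma>. \<Sum>\<tau>'\<in>faces S \<sigma> - {\<tau>}. g \<tau>') has_sum (\<Sum>\<^sub>\<infinity>\<tau>'\<in>S. g \<tau>')) (cofaces S \<tau>)"
proof -
  have "(g has_sum (\<Sum>\<^sub>\<infinity>\<tau>'\<in>S. g \<tau>')) S"
    using assms(2) by simp
  then have "((\<lambda>(\<sigma>, \<tau>'). g \<tau>') has_sum (\<Sum>\<^sub>\<infinity>\<tau>'\<in>S. g \<tau>'))
      (SIGMA \<sigma>:cofaces S \<tau>. faces S \<sigma> - {\<tau>})"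
    using has_sum_upper_neighbours[of \<tau> g] assms(1) by blast
  moreover have "(g has_sum (\<Sum>\<tau>'\<in>faces S \<sigma> - {\<tau>}. g \<tau>')) (faces S \<sigma> - {\<tau>})"
    if "\<sigma> \<in> cofaces S \<tau>" for \<sigma>
    using that finite_faces[of \<sigma>] by (intro has_sum_finiteI) (auto dest: coface_inD)
  ultimately show ?thesis
    using has_sum_Sigma'[where f = "\<lambda>(\<sigma>, \<tau>'). g \<tau>'" and A = "cofaces S \<tau>"
        and b = "\<lambda>\<sigma>. \<Sum>\<tau>'\<in>faces S \<sigma> - {\<tau>}. g \<tau>'"] by simp
qed

text \<open>The pieces \<open>cofaces S \<rho> - {\<tau>}\<close> are disjoint because \<rho> =
  \<tau> \<inter> \<tau>', and they cover the support of \<open>bm \<tau>\<close>. There are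
  finitely many of them, so their sums simply add up.\<close>

lemma has_sum_lower_neighbours:
  fixes g :: "'v set \<Rightarrow> real"
  assumes "\<tau> \<in> S" and "\<And>\<tau>'. bm \<tau> \<tau>' = 0 \<Longrightarrow> g \<tau>' = 0"
    and "\<And>\<rho>. coface S \<rho> \<tau> \<Longrightarrow> (g has_sum h \<rho>) (cofaces S \<rho> - {\<tau>})"
  shows "(g has_sum (\<Sum>\<rho>\<in>faces S \<tau>. h \<rho>)) S"
proof -
  have "(g has_sum (\<Sum>\<rho>\<in>faces S \<tau>. h \<rho>)) (\<Union>\<rho>\<in>faces S \<tau>. cofaces S \<rho> - {\<tau>})"
  proof (rule has_sum_UN_disjoint)
    show "disjoint_family_on (\<lambda>\<rho>. cofaces S \<rho> - {\<tau>}) (faces S \<tau>)"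
      unfolding disjoint_family_on_def
    proof (intro ballI impI equals0I)
      fix \<rho> \<rho>' \<tau>' assume "\<rho> \<in> faces S \<tau>" "\<rho>' \<in> faces S \<tau>" "\<rho> \<noteq> \<rho>'"
        "\<tau>' \<in> (cofaces S \<rho> - {\<tau>}) \<inter> (cofaces S \<rho>' - {\<tau>})"
      then show False
        using coface_Int_eq[of S \<rho> \<tau> \<tau>'] coface_Int_eq[of S \<rho>' \<tau> \<tau>'] by auto
    qed
  qed (use assms finite_faces in auto)
  also have "?this \<longleftrightarrow> ?thesis"
  proof (rule has_sum_cong_neutral)
    fix \<tau>' assume *: "\<tau>' \<in> S - (\<Union>\<rho>\<in>faces S \<tau>. cofaces S \<rho> - {\<tau>})"
    have "bm \<tau> \<tau>' = 0"
    proof (rule ccontr)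
      assume "bm \<tau> \<tau>' \<noteq> 0"
      from b_minus_nonzeroD[OF this] show False
        using * by auto
    qed
    then show "g \<tau>' = 0"
      by (rule assms)
  qed (auto dest: coface_inD)
  finally show ?thesis .
qed

text \<open>The empty set is never among the other faces, so this also holds if it has been
  discarded from \<open>S\<close>.\<close>

lemma card_other_faces:
  assumes "coface S \<tau> \<sigma>"
  shows "card (faces S \<sigma> - {\<tau>}) = card \<tau>"
proof -
  obtain w where w: "w \<notin> \<tau>" "\<sigma> = insert w \<tau>" "\<tau> \<in> S" "\<sigma> \<in> S"
    using assms by (auto simp: coface_iff)
  \<comment> \<open>A face of \<sigma> other than \<tau> keeps the new vertex \<open>w\<close> and
    drops a vertex of \<tau>; this puts the other faces in bijection with the vertices of
    \<tau>.\<close>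
  have "faces S \<sigma> - {\<tau>} = (\<lambda>v. \<sigma> - {v}) ` \<tau>"
  proof (intro equalityI subsetI)
    fix \<tau>' assume "\<tau>' \<in> faces S \<sigma> - {\<tau>}"
    then obtain v where "v \<notin> \<tau>'" "\<sigma> = insert v \<tau>'" "\<tau>' \<noteq> \<tau>"
      by (auto simp: coface_iff)
    moreover from this have "v \<in> \<tau>"
      using w(1,2) by (metis Diff_insert_absorb insertE insertI1)
    ultimately have "\<tau>' = \<sigma> - {v}" "v \<in> \<tau>"
      by auto
    then show "\<tau>' \<in> (\<lambda>v. \<sigma> - {v}) ` \<tau>"
      by blast
  next
    fix \<tau>' assume "\<tau>' \<in> (\<lambda>v. \<sigma> - {v}) ` \<tau>"
    then obtain v where v: "v \<in> \<tau>" "\<tau>' = \<sigma> - {v}"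
      by blast
    have "w \<in> \<tau>'"
      using v w(1,2) by auto
    then have "\<tau>' \<in> S"
      using v(2) by (intro nonempty_face[OF w(4)]) auto
    moreover have "v \<notin> \<tau>'" "\<sigma> = insert v \<tau>'"
      using v w(2) by (simp_all add: insert_absorb)
    ultimately have "coface S \<tau>' \<sigma>"
      using w(4) unfolding coface_iff by blast
    then show "\<tau>' \<in> faces S \<sigma> - {\<tau>}"
      using \<open>w \<in> \<tau>'\<close> w(1) by auto
  qed
  moreover have "inj_on (\<lambda>v. \<sigma> - {v}) \<tau>"
    using w by (auto intro!: inj_onI)
  ultimately show ?thesis
    by (simp add: card_image)
qed

lemma sum_other_faces:
  assumes "coface S \<tau> \<sigma>"
  shows "(\<Sum>\<tau>'\<in>faces S \<sigma> - {\<tau>}. bp \<tau> \<tau>') = real (card \<tau>) * m \<sigma>"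
proof -
  have "(\<Sum>\<tau>'\<in>faces S \<sigma> - {\<tau>}. bp \<tau> \<tau>') = (\<Sum>\<tau>'\<in>faces S \<sigma> - {\<tau>}. m \<sigma>)"
    using assms by (intro sum.cong) (auto simp: plus_cofaces)
  also have "\<dots> = real (card (faces S \<sigma> - {\<tau>})) * m \<sigma>"
    by (rule sum_constant)
  finally show ?thesis
    by (simp only: card_other_faces[OF assms])
qed

text \<open>All terms are nonnegative, and grouping them by the coface \<sigma> counts
  \<open>m \<sigma>\<close> once for each of the \<open>card \<tau>\<close> other faces of \<sigma>;
  local summability then applies.\<close>

lemma b_plus_summable:
  assumes "\<tau> \<in> S"
  shows "bp \<tau> summable_on S"
proof -
  have "(\<lambda>(\<sigma>, \<tau>'). bp \<tau> \<tau>') summable_on (SIGMA \<sigma>:cofaces S \<tau>. faces S \<sigma> - {\<tau>})"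
  proof (rule summable_on_SigmaI)
    show "((\<lambda>\<tau>'. case (\<sigma>, \<tau>') of (\<sigma>, \<tau>') \<Rightarrow> bp \<tau> \<tau>') has_sum real (card \<tau>) * m \<sigma>)
        (faces S \<sigma> - {\<tau>})" if "\<sigma> \<in> cofaces S \<tau>" for \<sigma>
      using that finite_faces[of \<sigma>]
      by (auto intro!: has_sum_finiteI simp: sum_other_faces coface_inD)
    show "(\<lambda>\<sigma>. real (card \<tau>) * m \<sigma>) summable_on cofaces S \<tau>"
      by (intro summable_on_cmult_right summable_cofaces assms)
  qed (simp add: b_plus_nonneg)
  then show ?thesis
    using has_sum_upper_neighbours[of \<tau> "bp \<tau>"] assms by (auto simp: summable_on_def)
qed

lemma infsum_b_plus:
  assumes "\<tau> \<in> S"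
  shows "(\<Sum>\<^sub>\<infinity>\<tau>'\<in>S. bp \<tau> \<tau>') = real (card \<tau>) * (\<Sum>\<^sub>\<infinity>\<sigma>\<in>cofaces S \<tau>. m \<sigma>)"
proof -
  have "((\<lambda>\<sigma>. \<Sum>\<tau>'\<in>faces S \<sigma> - {\<tau>}. bp \<tau> \<tau>') has_sum (\<Sum>\<^sub>\<infinity>\<tau>'\<in>S. bp \<tau> \<tau>')) (cofaces S \<tau>)"
    using assms b_plus_summable by (intro has_sum_over_cofaces)
  also have "?this \<longleftrightarrow>
      ((\<lambda>\<sigma>. real (card \<tau>) * m \<sigma>) has_sum (\<Sum>\<^sub>\<infinity>\<tau>'\<in>S. bp \<tau> \<tau>')) (cofaces S \<tau>)"
    by (rule has_sum_cong) (simp add: sum_other_faces)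
  finally have "(\<Sum>\<^sub>\<infinity>\<sigma>\<in>cofaces S \<tau>. real (card \<tau>) * m \<sigma>) = (\<Sum>\<^sub>\<infinity>\<tau>'\<in>S. bp \<tau> \<tau>')"
    by (rule infsumI)
  then show ?thesis
    by (simp add: infsum_cmult_right')
qed

section \<open>The composition \<partial>\<delta>\<close>

text \<open>In \<delta>\<omega>(\<sigma>) the contribution of \<tau> is separated from that of the
  other faces. Multiplied by \<open>\<theta> \<tau> \<sigma>\<close>, the first has sign 1 and gives
  the diagonal coefficient; the others regroup into the sum over neighbours. The first claim is the
  domain condition of \<partial> for \<delta>\<omega> at \<tau>.\<close>

lemma boundary_of_coboundary:
  assumes "\<omega> \<in> F S" "\<tau> \<in> S" and sm: "(\<lambda>\<tau>'. bp \<tau> \<tau>' * \<bar>\<omega> \<tau>'\<bar>) summable_on S"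
  shows "(\<lambda>\<sigma>. m \<sigma> * \<bar>d \<omega> \<sigma>\<bar>) summable_on cofaces S \<tau>"
    and "(\<Sum>\<^sub>\<infinity>\<sigma>\<in>cofaces S \<tau>. m \<sigma> * d \<omega> \<sigma> * \<theta> \<tau> \<sigma>) =
      (\<Sum>\<^sub>\<infinity>\<sigma>\<in>cofaces S \<tau>. m \<sigma>) * \<omega> \<tau> - (\<Sum>\<^sub>\<infinity>\<tau>'\<in>S. bp \<tau> \<tau>' * op \<tau> \<tau>' * \<omega> \<tau>')"
proof -
  have split: "d \<omega> \<sigma> = \<omega> \<tau> * \<theta> \<tau> \<sigma> + (\<Sum>\<tau>'\<in>faces S \<sigma> - {\<tau>}. \<omega> \<tau>' * \<theta> \<tau>' \<sigma>)"
    if "coface S \<tau> \<sigma>" for \<sigma>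
    using that finite_faces[of \<sigma>] assms(1)
    by (simp add: coboundary_apply coface_inD sum.remove[of _ \<tau>])
  have "(\<lambda>\<sigma>. \<Sum>\<tau>'\<in>faces S \<sigma> - {\<tau>}. bp \<tau> \<tau>' * \<bar>\<omega> \<tau>'\<bar>) summable_on cofaces S \<tau>"
    using has_sum_over_cofaces[OF _ sm] by (auto simp: summable_on_def)
  \<comment> \<open>This majorant comes from the triangle inequality in \<open>split\<close>: local
    summability controls the first term, the hypothesis on \<omega> the second.\<close>
  then have "(\<lambda>\<sigma>. \<bar>\<omega> \<tau>\<bar> * m \<sigma> + (\<Sum>\<tau>'\<in>faces S \<sigma> - {\<tau>}. bp \<tau> \<tau>' * \<bar>\<omega> \<tau>'\<bar>))
      summable_on cofaces S \<tau>"
    by (intro summable_on_add summable_on_cmult_right summable_cofaces assms)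
  then show "(\<lambda>\<sigma>. m \<sigma> * \<bar>d \<omega> \<sigma>\<bar>) summable_on cofaces S \<tau>"
  proof (rule summable_on_real_comparison)
    fix \<sigma> assume \<sigma>: "\<sigma> \<in> cofaces S \<tau>"
    have "\<bar>d \<omega> \<sigma>\<bar> \<le> \<bar>\<omega> \<tau> * \<theta> \<tau> \<sigma>\<bar> + \<bar>\<Sum>\<tau>'\<in>faces S \<sigma> - {\<tau>}. \<omega> \<tau>' * \<theta> \<tau>' \<sigma>\<bar>"
      using \<sigma> by (simp add: split)
    also have "\<dots> \<le> \<bar>\<omega> \<tau>\<bar> + (\<Sum>\<tau>'\<in>faces S \<sigma> - {\<tau>}. \<bar>\<omega> \<tau>'\<bar>)"
      using \<sigma> by (auto simp: abs_mult abs_theta intro!: sum_abs[THEN order_trans] sum_mono)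
    finally have "m \<sigma> * \<bar>d \<omega> \<sigma>\<bar> \<le> m \<sigma> * (\<bar>\<omega> \<tau>\<bar> + (\<Sum>\<tau>'\<in>faces S \<sigma> - {\<tau>}. \<bar>\<omega> \<tau>'\<bar>))"
      using \<sigma> coface_pos[of \<tau> \<sigma>] by (intro mult_left_mono) auto
    also have "\<dots> = \<bar>\<omega> \<tau>\<bar> * m \<sigma> + (\<Sum>\<tau>'\<in>faces S \<sigma> - {\<tau>}. bp \<tau> \<tau>' * \<bar>\<omega> \<tau>'\<bar>)"
      using \<sigma> by (simp add: plus_cofaces algebra_simps sum_distrib_left)
    finally show "\<bar>m \<sigma> * \<bar>d \<omega> \<sigma>\<bar>\<bar> \<le> \<dots>"
      using \<sigma> coface_pos[of \<tau> \<sigma>] by simp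
  qed
  have "(\<lambda>\<tau>'. bp \<tau> \<tau>' * op \<tau> \<tau>' * \<omega> \<tau>') summable_on S"
    by (intro summable_signed sm b_plus_nonneg abs_o_plus_le)
  then have "((\<lambda>\<sigma>. - (\<Sum>\<tau>'\<in>faces S \<sigma> - {\<tau>}. bp \<tau> \<tau>' * op \<tau> \<tau>' * \<omega> \<tau>')) has_sum
      - (\<Sum>\<^sub>\<infinity>\<tau>'\<in>S. bp \<tau> \<tau>' * op \<tau> \<tau>' * \<omega> \<tau>')) (cofaces S \<tau>)"
    using has_sum_over_cofaces[of \<tau> "\<lambda>\<tau>'. bp \<tau> \<tau>' * op \<tau> \<tau>' * \<omega> \<tau>'"]
    by (simp add: has_sum_uminus)
  moreover have "((\<lambda>\<sigma>. m \<sigma> * \<omega> \<tau>) has_sum (\<Sum>\<^sub>\<infinity>\<sigma>\<in>cofaces S \<tau>. m \<sigma>) * \<omega> \<tau>) (cofaces S \<tau>)"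
    using summable_cofaces[OF assms(2)] by (intro has_sum_cmult_left) simp
  ultimately have "((\<lambda>\<sigma>. m \<sigma> * \<omega> \<tau> + - (\<Sum>\<tau>'\<in>faces S \<sigma> - {\<tau>}. bp \<tau> \<tau>' * op \<tau> \<tau>' * \<omega> \<tau>')) has_sum
      (\<Sum>\<^sub>\<infinity>\<sigma>\<in>cofaces S \<tau>. m \<sigma>) * \<omega> \<tau> + - (\<Sum>\<^sub>\<infinity>\<tau>'\<in>S. bp \<tau> \<tau>' * op \<tau> \<tau>' * \<omega> \<tau>')) (cofaces S \<tau>)"
    by (intro has_sum_add)
  also have "?this \<longleftrightarrow> ((\<lambda>\<sigma>. m \<sigma> * d \<omega> \<sigma> * \<theta> \<tau> \<sigma>) has_sum
      (\<Sum>\<^sub>\<infinity>\<sigma>\<in>cofaces S \<tau>. m \<sigma>) * \<omega> \<tau> + - (\<Sum>\<^sub>\<infinity>\<tau>'\<in>S. bp \<tau> \<tau>' * op \<tau> \<tau>' * \<omega> \<tau>')) (cofaces S \<tau>)"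
  proof (rule has_sum_cong)
    fix \<sigma> assume \<sigma>: "\<sigma> \<in> cofaces S \<tau>"
    \<comment> \<open>The minus sign cancels the one in \<open>o_plus\<close>, and the factor
      \<open>m \<sigma> * \<theta> \<tau> \<sigma>\<close> is common to all \<tau>'.\<close>
    have "- (\<Sum>\<tau>'\<in>faces S \<sigma> - {\<tau>}. bp \<tau> \<tau>' * op \<tau> \<tau>' * \<omega> \<tau>')
        = m \<sigma> * \<theta> \<tau> \<sigma> * (\<Sum>\<tau>'\<in>faces S \<sigma> - {\<tau>}. \<omega> \<tau>' * \<theta> \<tau>' \<sigma>)"
      using \<sigma> by (simp add: plus_cofaces sum_distrib_left sum_negf mult_ac)
    then show "m \<sigma> * \<omega> \<tau> + - (\<Sum>\<tau>'\<in>faces S \<sigma> - {\<tau>}. bp \<tau> \<tau>' * op \<tau> \<tau>' * \<omega> \<tau>')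
        = m \<sigma> * d \<omega> \<sigma> * \<theta> \<tau> \<sigma>"
      using \<sigma> by (simp add: split algebra_simps theta_square)
  qed
  finally show "(\<Sum>\<^sub>\<infinity>\<sigma>\<in>cofaces S \<tau>. m \<sigma> * d \<omega> \<sigma> * \<theta> \<tau> \<sigma>) =
      (\<Sum>\<^sub>\<infinity>\<sigma>\<in>cofaces S \<tau>. m \<sigma>) * \<omega> \<tau> - (\<Sum>\<^sub>\<infinity>\<tau>'\<in>S. bp \<tau> \<tau>' * op \<tau> \<tau>' * \<omega> \<tau>')"
    by (auto dest: infsumI)
qed

section \<open>The domain of \<partial> and the composition \<delta>\<partial>\<close>

abbreviation bdry where "bdry \<equiv> oapp (boundary_op S m d)"

lemma boundary_apply:
  "\<rho> \<in> S \<Longrightarrow> bdry \<omega> \<rho> = 1 / m \<rho> * (\<Sum>\<^sub>\<infinity>\<tau>\<in>cofaces S \<rho>. m \<tau> * \<omega> \<tau> * \<theta> \<rho> \<tau>)"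
  by (simp add: boundary_op_def)

lemma boundary_in_F: "bdry \<omega> \<in> F S"
  by (simp add: boundary_op_def F_def)

text \<open>On \<open>cofaces S \<rho> - {\<tau>}\<close> the weight \<open>bm \<tau>\<close> is
  \<open>m\<close> times the constant \<open>m \<tau> / m \<rho>\<close>. From left to right the
  finitely many faces of \<tau> are glued together; from right to left the sum is restricted to the
  cofaces of a single \<rho>.\<close>

lemma F1_iff:
  assumes "\<omega> \<in> F S"
  shows "\<omega> \<in> F1 S m \<longleftrightarrow> (\<forall>\<tau>\<in>S. (\<lambda>\<tau>'. bm \<tau> \<tau>' * \<bar>\<omega> \<tau>'\<bar>) summable_on S)"
proof
  assume F1: "\<omega> \<in> F1 S m"
  show "\<forall>\<tau>\<in>S. (\<lambda>\<tau>'. bm \<tau> \<tau>' * \<bar>\<omega> \<tau>'\<bar>) summable_on S"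
  proof
    fix \<tau> assume "\<tau> \<in> S"
    have "(\<lambda>\<tau>'. bm \<tau> \<tau>' * \<bar>\<omega> \<tau>'\<bar>) summable_on cofaces S \<rho> - {\<tau>}" if "coface S \<rho> \<tau>" for \<rho>
    proof -
      have "(\<lambda>\<tau>'. m \<tau>' * \<bar>\<omega> \<tau>'\<bar>) summable_on cofaces S \<rho>"
        using F1 coface_inD(1)[OF that] by (simp add: F1_def)
      then have "(\<lambda>\<tau>'. m \<tau>' * \<bar>\<omega> \<tau>'\<bar>) summable_on cofaces S \<rho> - {\<tau>}"
        by (rule summable_on_subset_banach) auto
      then have "(\<lambda>\<tau>'. m \<tau> / m \<rho> * (m \<tau>' * \<bar>\<omega> \<tau>'\<bar>)) summable_on cofaces S \<rho> - {\<tau>}"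
        by (rule summable_on_cmult_right)
      also have "?this \<longleftrightarrow> ?thesis"
        using that by (intro summable_on_cong) (simp add: minus_cofaces)
      finally show ?thesis .
    qed
    then have "((\<lambda>\<tau>'. bm \<tau> \<tau>' * \<bar>\<omega> \<tau>'\<bar>) has_sum
        (\<Sum>\<rho>\<in>faces S \<tau>. \<Sum>\<^sub>\<infinity>\<tau>'\<in>cofaces S \<rho> - {\<tau>}. bm \<tau> \<tau>' * \<bar>\<omega> \<tau>'\<bar>)) S"
      using \<open>\<tau> \<in> S\<close> by (intro has_sum_lower_neighbours) auto
    then show "(\<lambda>\<tau>'. bm \<tau> \<tau>' * \<bar>\<omega> \<tau>'\<bar>) summable_on S"
      by (auto simp: summable_on_def)
  qed
next
  assume sm: "\<forall>\<tau>\<in>S. (\<lambda>\<tau>'. bm \<tau> \<tau>' * \<bar>\<omega> \<tau>'\<bar>) summable_on S"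
  have "(\<lambda>\<sigma>. m \<sigma> * \<bar>\<omega> \<sigma>\<bar>) summable_on cofaces S \<rho>" for \<rho>
  proof (cases "cofaces S \<rho> = {}")
    case False
    \<comment> \<open>Any coface of \<rho> can serve as base point; the single term lost at \<tau>
      itself is put back at the end.\<close>
    then obtain \<tau> where \<tau>: "coface S \<rho> \<tau>"
      by auto
    have "(\<lambda>\<tau>'. bm \<tau> \<tau>' * \<bar>\<omega> \<tau>'\<bar>) summable_on cofaces S \<rho> - {\<tau>}"
      using sm[rule_format, OF coface_inD(2)[OF \<tau>]]
      by (rule summable_on_subset_banach) (auto dest: coface_inD)
    also have "?this \<longleftrightarrow>
        (\<lambda>\<tau>'. m \<tau> / m \<rho> * (m \<tau>' * \<bar>\<omega> \<tau>'\<bar>)) summable_on cofaces S \<rho> - {\<tau>}"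
      using \<tau> by (intro summable_on_cong) (simp add: minus_cofaces)
    also have "\<dots> \<longleftrightarrow> (\<lambda>\<tau>'. m \<tau>' * \<bar>\<omega> \<tau>'\<bar>) summable_on cofaces S \<rho> - {\<tau>}"
      using coface_pos[OF \<tau>] by (intro summable_on_cmult_right') simp
    finally have "(\<lambda>\<tau>'. m \<tau>' * \<bar>\<omega> \<tau>'\<bar>) summable_on insert \<tau> (cofaces S \<rho> - {\<tau>})"
      by (simp only: summable_on_insert_iff)
    then show ?thesis
      using \<tau> by (simp add: insert_absorb)
  qed simp
  then show "\<omega> \<in> F1 S m"
    using assms by (simp add: F1_def)
qed

lemma F1_signed_summable:
  assumes "\<omega> \<in> F1 S m" "\<rho> \<in> S"
  shows "(\<lambda>\<tau>. m \<tau> * \<omega> \<tau> * \<theta> \<rho> \<tau>) summable_on cofaces S \<rho>"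
proof -
  have "(\<lambda>\<tau>. m \<tau> * \<theta> \<rho> \<tau> * \<omega> \<tau>) summable_on cofaces S \<rho>"
    using assms by (intro summable_signed)
      (auto simp: F1_def abs_theta intro: less_imp_le coface_pos)
  then show ?thesis
    by (simp add: mult_ac)
qed

text \<open>Each face \<rho> of \<tau> contributes its boundary series. The term at \<tau> yields
  the diagonal part, the remainder the part of the off-diagonal sum running over neighbours that
  share \<rho>. The factor \<open>m \<tau>\<close> on the left matches the symmetric form of
  \<open>b_minus\<close>.\<close>

lemma coboundary_of_boundary:
  assumes "\<omega> \<in> F1 S m" "\<tau> \<in> S"
  shows "m \<tau> * d (bdry \<omega>) \<tau> = (\<Sum>\<rho>\<in>faces S \<tau>. (m \<tau>)\<^sup>2 / m \<rho>) * \<omega> \<tau>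
    - (\<Sum>\<^sub>\<infinity>\<tau>'\<in>S. bm \<tau> \<tau>' * om \<tau> \<tau>' * \<omega> \<tau>')"
proof -
  \<comment> \<open>\<open>R \<rho>\<close> is the series of m(\<rho>) \<partial>\<omega>(\<rho>)
    without the term at \<tau>.\<close>
  define R where "R \<rho> = (\<Sum>\<^sub>\<infinity>\<tau>'\<in>cofaces S \<rho> - {\<tau>}. m \<tau>' * \<omega> \<tau>' * \<theta> \<rho> \<tau>')" for \<rho>
  have sm: "(\<lambda>\<tau>'. m \<tau>' * \<omega> \<tau>' * \<theta> \<rho> \<tau>') summable_on cofaces S \<rho> - {\<tau>}"
    if "coface S \<rho> \<tau>" for \<rho>
    using F1_signed_summable[OF assms(1) coface_inD(1)[OF that]]
    by (rule summable_on_subset_banach) auto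
  have "((\<lambda>\<tau>'. bm \<tau> \<tau>' * om \<tau> \<tau>' * \<omega> \<tau>') has_sum
      (\<Sum>\<rho>\<in>faces S \<tau>. - (m \<tau> / m \<rho> * \<theta> \<rho> \<tau>) * R \<rho>)) S"
  proof (rule has_sum_lower_neighbours)
    fix \<rho> assume \<rho>: "coface S \<rho> \<tau>"
    have "((\<lambda>\<tau>'. - (m \<tau> / m \<rho> * \<theta> \<rho> \<tau>) * (m \<tau>' * \<omega> \<tau>' * \<theta> \<rho> \<tau>')) has_sum
        - (m \<tau> / m \<rho> * \<theta> \<rho> \<tau>) * R \<rho>) (cofaces S \<rho> - {\<tau>})"
      unfolding R_def using sm[OF \<rho>] by (intro has_sum_cmult_right) simp
    also have "?this \<longleftrightarrow> ((\<lambda>\<tau>'. bm \<tau> \<tau>' * om \<tau> \<tau>' * \<omega> \<tau>') has_sum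
        - (m \<tau> / m \<rho> * \<theta> \<rho> \<tau>) * R \<rho>) (cofaces S \<rho> - {\<tau>})"
      using \<rho> by (intro has_sum_cong) (simp add: minus_cofaces)
    finally show "((\<lambda>\<tau>'. bm \<tau> \<tau>' * om \<tau> \<tau>' * \<omega> \<tau>') has_sum
        - (m \<tau> / m \<rho> * \<theta> \<rho> \<tau>) * R \<rho>) (cofaces S \<rho> - {\<tau>})" .
  qed (use assms in auto)
  then have R: "(\<Sum>\<^sub>\<infinity>\<tau>'\<in>S. bm \<tau> \<tau>' * om \<tau> \<tau>' * \<omega> \<tau>') =
      (\<Sum>\<rho>\<in>faces S \<tau>. - (m \<tau> / m \<rho> * \<theta> \<rho> \<tau>) * R \<rho>)"
    by (rule infsumI)
  have "m \<tau> * d (bdry \<omega>) \<tau> = (\<Sum>\<rho>\<in>faces S \<tau>. m \<tau> * (bdry \<omega> \<rho> * \<theta> \<rho> \<tau>))"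
    using assms boundary_in_F by (simp add: coboundary_apply sum_distrib_left)
  also have "\<dots> = (\<Sum>\<rho>\<in>faces S \<tau>. (m \<tau>)\<^sup>2 / m \<rho> * \<omega> \<tau> - - (m \<tau> / m \<rho> * \<theta> \<rho> \<tau>) * R \<rho>)"
  proof (rule sum.cong)
    fix \<rho> assume "\<rho> \<in> faces S \<tau>"
    then have \<rho>: "coface S \<rho> \<tau>"
      by simp
    have "(\<Sum>\<^sub>\<infinity>\<tau>'\<in>insert \<tau> (cofaces S \<rho> - {\<tau>}). m \<tau>' * \<omega> \<tau>' * \<theta> \<rho> \<tau>') =
        m \<tau> * \<omega> \<tau> * \<theta> \<rho> \<tau> + R \<rho>"
      unfolding R_def using sm[OF \<rho>] by (intro infsum_insert) auto
    then have "bdry \<omega> \<rho> = 1 / m \<rho> * (m \<tau> * \<omega> \<tau> * \<theta> \<rho> \<tau> + R \<rho>)"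
      using \<rho> coface_inD(1)[OF \<rho>] by (simp add: boundary_apply insert_absorb)
    then have "m \<tau> * (bdry \<omega> \<rho> * \<theta> \<rho> \<tau>) =
        m \<tau> * m \<tau> / m \<rho> * \<omega> \<tau> * (\<theta> \<rho> \<tau> * \<theta> \<rho> \<tau>) + m \<tau> / m \<rho> * \<theta> \<rho> \<tau> * R \<rho>"
      by (simp add: algebra_simps add_divide_distrib)
    then show "m \<tau> * (bdry \<omega> \<rho> * \<theta> \<rho> \<tau>) =
        (m \<tau>)\<^sup>2 / m \<rho> * \<omega> \<tau> - - (m \<tau> / m \<rho> * \<theta> \<rho> \<tau>) * R \<rho>"
      by (simp add: theta_square[OF \<rho>] power2_eq_square)
  qed simp
  finally show ?thesis
    by (simp only: R sum_subtractf sum_distrib_right)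
qed

section \<open>Total edge weights, potentials, and the operators \<open>H_plus\<close> and
  \<open>H_minus\<close>\<close>

lemma has_sum_b_minus:
  assumes "\<tau> \<in> S"
  shows "(bm \<tau> has_sum (\<Sum>\<rho>\<in>faces S \<tau>. m \<tau> / m \<rho> * (\<Sum>\<^sub>\<infinity>\<tau>'\<in>cofaces S \<rho> - {\<tau>}. m \<tau>'))) S"
proof (rule has_sum_lower_neighbours)
  fix \<rho> assume \<rho>: "coface S \<rho> \<tau>"
  have "m summable_on cofaces S \<rho> - {\<tau>}"
    using summable_cofaces[OF coface_inD(1)[OF \<rho>]] by (rule summable_on_subset_banach) auto
  then have "((\<lambda>\<tau>'. m \<tau> / m \<rho> * m \<tau>') has_sum
      m \<tau> / m \<rho> * (\<Sum>\<^sub>\<infinity>\<tau>'\<in>cofaces S \<rho> - {\<tau>}. m \<tau>')) (cofaces S \<rho> - {\<tau>})"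
    by (intro has_sum_cmult_right) simp
  also have "?this \<longleftrightarrow> (bm \<tau> has_sum
      m \<tau> / m \<rho> * (\<Sum>\<^sub>\<infinity>\<tau>'\<in>cofaces S \<rho> - {\<tau>}. m \<tau>')) (cofaces S \<rho> - {\<tau>})"
    using \<rho> by (intro has_sum_cong) (simp add: minus_cofaces)
  finally show "(bm \<tau> has_sum
      m \<tau> / m \<rho> * (\<Sum>\<^sub>\<infinity>\<tau>'\<in>cofaces S \<rho> - {\<tau>}. m \<tau>')) (cofaces S \<rho> - {\<tau>})" .
qed (use assms in auto)

text \<open>The total edge weight is \<open>card \<tau>\<close> = dim(\<tau>) + 1 times the mass of
  the cofaces; taking it away from one such mass leaves the factor -dim(\<tau>).\<close>

lemma c_plus_eq:
  assumes "\<tau> \<in> S"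
  shows "c_plus S m \<tau> = (\<Sum>\<^sub>\<infinity>\<sigma>\<in>cofaces S \<tau>. m \<sigma>) - (\<Sum>\<^sub>\<infinity>\<tau>'\<in>S. bp \<tau> \<tau>')"
  unfolding c_plus_def infsum_b_plus[OF assms] sdim_def by (simp add: algebra_simps)

lemma c_minus_eq:
  assumes "\<tau> \<in> S"
  shows "c_minus S m \<tau> = (\<Sum>\<rho>\<in>faces S \<tau>. (m \<tau>)\<^sup>2 / m \<rho>) - (\<Sum>\<^sub>\<infinity>\<tau>'\<in>S. bm \<tau> \<tau>')"
  unfolding c_minus_def infsumI[OF has_sum_b_minus[OF assms]] sum_subtractf[symmetric]
  by (intro sum.cong) (simp_all add: power2_eq_square algebra_simps diff_divide_distrib)

text \<open>The total edge weight enters once through the Laplacian part and once, negatively,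
  through the potential. It cancels, so \<open>a\<close> remains as the diagonal coefficient. The
  two summability assumptions permit splitting the series.\<close>

lemma schroedinger_apply:
  assumes "\<tau> \<in> S" "b \<tau> summable_on S" "(\<lambda>\<tau>'. b \<tau> \<tau>' * s \<tau> \<tau>' * \<omega> \<tau>') summable_on S"
    and "c \<tau> = a - (\<Sum>\<^sub>\<infinity>\<tau>'\<in>S. b \<tau> \<tau>')"
  shows "oapp (schroedinger_op S m b s c) \<omega> \<tau> =
    1 / m \<tau> * (a * \<omega> \<tau> - (\<Sum>\<^sub>\<infinity>\<tau>'\<in>S. b \<tau> \<tau>' * s \<tau> \<tau>' * \<omega> \<tau>'))"
proof -
  have "((\<lambda>\<tau>'. b \<tau> \<tau>' * \<omega> \<tau> + - (b \<tau> \<tau>' * s \<tau> \<tau>' * \<omega> \<tau>')) has_sum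
      (\<Sum>\<^sub>\<infinity>\<tau>'\<in>S. b \<tau> \<tau>') * \<omega> \<tau> + - (\<Sum>\<^sub>\<infinity>\<tau>'\<in>S. b \<tau> \<tau>' * s \<tau> \<tau>' * \<omega> \<tau>')) S"
    using assms(2,3) by (intro has_sum_add has_sum_cmult_left has_sum_uminusI) auto
  then have "(\<Sum>\<^sub>\<infinity>\<tau>'\<in>S. b \<tau> \<tau>' * \<omega> \<tau> + - (b \<tau> \<tau>' * s \<tau> \<tau>' * \<omega> \<tau>')) =
      (\<Sum>\<^sub>\<infinity>\<tau>'\<in>S. b \<tau> \<tau>') * \<omega> \<tau> + - (\<Sum>\<^sub>\<infinity>\<tau>'\<in>S. b \<tau> \<tau>' * s \<tau> \<tau>' * \<omega> \<tau>')"
    by (rule infsumI)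
  then have "(\<Sum>\<^sub>\<infinity>\<tau>'\<in>S. b \<tau> \<tau>' * (\<omega> \<tau> - s \<tau> \<tau>' * \<omega> \<tau>')) =
      (\<Sum>\<^sub>\<infinity>\<tau>'\<in>S. b \<tau> \<tau>') * \<omega> \<tau> - (\<Sum>\<^sub>\<infinity>\<tau>'\<in>S. b \<tau> \<tau>' * s \<tau> \<tau>' * \<omega> \<tau>')" (is "?l = ?B * _ - ?T")
    by (simp add: algebra_simps)
  moreover have "oapp (schroedinger_op S m b s c) \<omega> \<tau> = 1 / m \<tau> * ?l + (a - ?B) / m \<tau> * \<omega> \<tau>"
    using assms(1,4) by (simp add: schroedinger_op_def)
  ultimately show ?thesis
    by (simp only:) (simp add: left_diff_distrib diff_divide_distrib)
qed

lemma domain_H_plus: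
  "\<omega> \<in> odom (H_plus S m d) \<longleftrightarrow>
    \<omega> \<in> F S \<and> (\<forall>\<tau>\<in>S. (\<lambda>\<tau>'. bp \<tau> \<tau>' * \<bar>\<omega> \<tau>'\<bar>) summable_on S)"
  by (simp add: H_plus_def schroedinger_op_def)

lemma domain_H_minus: "odom (H_minus S m d) = F1 S m"
proof -
  have "\<omega> \<in> odom (H_minus S m d) \<longleftrightarrow> \<omega> \<in> F1 S m" for \<omega>
    using F1_iff[of \<omega>] by (auto simp: H_minus_def schroedinger_op_def F1_def)
  then show ?thesis
    by blast
qed

lemma H_plus_eq:
  assumes "\<omega> \<in> odom (H_plus S m d)"
  shows "d \<omega> \<in> F1 S m" and "\<tau> \<in> S \<Longrightarrow> oapp (H_plus S m d) \<omega> \<tau> = bdry (d \<omega>) \<tau>"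
proof -
  have \<omega>: "\<omega> \<in> F S" "\<And>\<tau>. \<tau> \<in> S \<Longrightarrow> (\<lambda>\<tau>'. bp \<tau> \<tau>' * \<bar>\<omega> \<tau>'\<bar>) summable_on S"
    using assms by (auto simp: domain_H_plus)
  then show "d \<omega> \<in> F1 S m"
    using boundary_of_coboundary(1)[OF \<omega>(1)] by (simp add: F1_def coboundary_in_F)
  assume \<tau>: "\<tau> \<in> S"
  show "oapp (H_plus S m d) \<omega> \<tau> = bdry (d \<omega>) \<tau>"
    unfolding H_plus_def boundary_apply[OF \<tau>] boundary_of_coboundary(2)[OF \<omega>(1) \<tau> \<omega>(2)[OF \<tau>]]
    using \<tau> \<omega>(2) by (intro schroedinger_apply b_plus_summable summable_signed c_plus_eq
        b_plus_nonneg abs_o_plus_le)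
qed

lemma H_minus_eq:
  assumes "\<omega> \<in> F1 S m" "\<tau> \<in> S"
  shows "oapp (H_minus S m d) \<omega> \<tau> = d (bdry \<omega>) \<tau>"
proof -
  have "\<omega> \<in> F S"
    using assms(1) by (simp add: F1_def)
  then have sm: "(\<lambda>\<tau>'. bm \<tau> \<tau>' * \<bar>\<omega> \<tau>'\<bar>) summable_on S"
    using F1_iff assms by blast
  have "oapp (H_minus S m d) \<omega> \<tau> = 1 / m \<tau> * ((\<Sum>\<rho>\<in>faces S \<tau>. (m \<tau>)\<^sup>2 / m \<rho>) * \<omega> \<tau>
      - (\<Sum>\<^sub>\<infinity>\<tau>'\<in>S. bm \<tau> \<tau>' * om \<tau> \<tau>' * \<omega> \<tau>'))"
    unfolding H_minus_def
    using assms(2) by (intro schroedinger_apply summable_signed sm c_minus_eq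
        b_minus_nonneg abs_o_minus_le has_sum_imp_summable[OF has_sum_b_minus])
  then show ?thesis
    using weight_pos[OF assms(2)] by (simp flip: coboundary_of_boundary[OF assms])
qed

section \<open>The Hodge case: consequences of \<delta>\<delta> = 0\<close>

text \<open>Between \<rho> = \<tau> \<inter> \<tau>' and \<sigma> there are exactly two simplices,
  \<tau> and \<tau>', so \<delta>\<delta> = 0 becomes a relation with two terms. Regularity of
  \<tau> ensures that \<rho> belongs to \<open>S\<close>.\<close>

lemma regular_common_face:
  assumes "\<tau> \<in> regular_simplices S" "coface S \<tau> \<sigma>" "coface S \<tau>' \<sigma>" "\<tau>' \<noteq> \<tau>"
  shows "coface S (\<tau> \<inter> \<tau>') \<tau>" "coface S (\<tau> \<inter> \<tau>') \<tau>'"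
    and "\<theta> (\<tau> \<inter> \<tau>') \<tau> * \<theta> \<tau> \<sigma> + \<theta> (\<tau> \<inter> \<tau>') \<tau>' * \<theta> \<tau>' \<sigma> = 0"
proof -
  define \<rho> where "\<rho> = \<tau> \<inter> \<tau>'"
  obtain v where v: "v \<notin> \<tau>" "\<sigma> = insert v \<tau>" "\<tau> \<in> S" "\<sigma> \<in> S"
    using assms(2) unfolding coface_iff by blast
  obtain w where w: "w \<notin> \<tau>'" "\<sigma> = insert w \<tau>'" "\<tau>' \<in> S"
    using assms(3) unfolding coface_iff by blast
  have "v \<noteq> w"
    using v w assms(4) by (metis Diff_insert_absorb)
  have "x = v \<or> x \<in> \<tau> \<longleftrightarrow> x = w \<or> x \<in> \<tau>'" for x
    using v(2) w(2) by (metis insert_iff)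
  then have "x \<in> \<tau> \<longleftrightarrow> x = w \<or> x \<in> \<rho>" "x \<in> \<tau>' \<longleftrightarrow> x = v \<or> x \<in> \<rho>" for x
    using v(1) w(1) \<open>v \<noteq> w\<close> unfolding \<rho>_def by (metis Int_iff)+
  then have "\<tau> = insert w \<rho>" "\<tau>' = insert v \<rho>"
    by blast+
  moreover have "v \<notin> \<rho>" "w \<notin> \<rho>"
    using v(1) w(1) by (simp_all add: \<rho>_def)
  ultimately have \<rho>: "v \<notin> \<rho>" "w \<notin> \<rho>" "\<tau> = insert w \<rho>" "\<tau>' = insert v \<rho>"
    by blast+
  have "\<rho> \<in> S"
  proof (cases "\<rho> = {}")
    case True
    \<comment> \<open>If \<rho> is empty, \<tau> is a vertex with the coface \<sigma>; such a vertex
      is regular only when the empty simplex is present.\<close>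
    then have "sdim \<tau> = 0"
      using \<rho>(3) by (simp add: sdim_def)
    then show ?thesis
      using assms(1,2) True by (auto simp: regular_simplices_def)
  next
    case False
    then show ?thesis
      using nonempty_face[OF v(3)] by (auto simp: \<rho>_def)
  qed
  then have cf: "coface S \<rho> \<tau>" "coface S \<rho> \<tau>'"
    unfolding coface_iff using \<rho> v(3) w(3) by metis+
  then show "coface S (\<tau> \<inter> \<tau>') \<tau>" "coface S (\<tau> \<inter> \<tau>') \<tau>'"
    by (simp_all add: \<rho>_def)
  have ind: "indicator {\<rho>} \<in> F S"
    using \<open>\<rho> \<in> S\<close> by (auto simp: F_def indicator_def)
  \<comment> \<open>Testing \<delta>\<delta> on the indicator of \<rho> turns its inner values into
    incidence numbers.\<close>
  have "0 = d (d (indicator {\<rho>})) \<sigma>"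
    using coboundary_coboundary[OF ind] by simp
  also have "\<dots> = (\<Sum>\<tau>''\<in>faces S \<sigma>. \<theta> \<rho> \<tau>'' * \<theta> \<tau>'' \<sigma>)"
    using coboundary_apply[OF coboundary_in_F[OF ind] v(4)] by (simp add: theta_def)
  also have "\<dots> = (\<Sum>\<tau>''\<in>{\<tau>, \<tau>'}. \<theta> \<rho> \<tau>'' * \<theta> \<tau>'' \<sigma>)"
  proof (rule sum.mono_neutral_right)
    show "\<forall>\<tau>''\<in>faces S \<sigma> - {\<tau>, \<tau>'}. \<theta> \<rho> \<tau>'' * \<theta> \<tau>'' \<sigma> = 0"
    proof
      fix \<tau>'' assume *: "\<tau>'' \<in> faces S \<sigma> - {\<tau>, \<tau>'}"
      \<comment> \<open>Adding a vertex of \<sigma> to \<rho> can only add \<open>v\<close> or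
        \<open>w\<close>, which gives \<tau>' or \<tau>.\<close>
      have "\<not> coface S \<rho> \<tau>''"
      proof
        assume "coface S \<rho> \<tau>''"
        then obtain x where x: "x \<notin> \<rho>" "\<tau>'' = insert x \<rho>"
          unfolding coface_iff by blast
        moreover have "\<tau>'' \<subseteq> \<sigma>"
          using * by (auto simp: coface_def)
        ultimately have "x \<in> \<sigma>"
          by blast
        then have "x = v \<or> x = w"
          using x(1) v(2) \<rho>(3) by simp
        then show False
          using * x(2) \<rho>(3,4) by auto
      qed
      then show "\<theta> \<rho> \<tau>'' * \<theta> \<tau>'' \<sigma> = 0"
        using * theta_eq_0[OF \<open>\<rho> \<in> S\<close>, of \<tau>''] by (auto dest: coface_inD)
    qed
  qed (use assms finite_faces[OF v(4)] in auto)
  also have "\<dots> = \<theta> \<rho> \<tau> * \<theta> \<tau> \<sigma> + \<theta> \<rho> \<tau>' * \<theta> \<tau>' \<sigma>"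
    using assms(4) by simp
  finally show "\<theta> (\<tau> \<inter> \<tau>') \<tau> * \<theta> \<tau> \<sigma> + \<theta> (\<tau> \<inter> \<tau>') \<tau>' * \<theta> \<tau>' \<sigma> = 0"
    by (simp add: \<rho>_def)
qed

text \<open>All four incidence numbers are 1 or -1, so the relation from \<delta>\<delta> = 0 fixes
  the product of the lower two as minus the product of the upper two.\<close>

lemma regular_opposite_signs:
  assumes "\<tau> \<in> regular_simplices S" "bp \<tau> \<tau>' \<noteq> 0"
  shows "bm \<tau> \<tau>' \<noteq> 0" "om \<tau> \<tau>' = - op \<tau> \<tau>'"
proof -
  define \<rho> \<sigma> where "\<rho> = \<tau> \<inter> \<tau>'" and "\<sigma> = \<tau> \<union> \<tau>'"
  have cf: "coface S \<tau> \<sigma>" "coface S \<tau>' \<sigma>" "\<tau>' \<noteq> \<tau>"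
    using b_plus_nonzeroD[OF assms(2)] by (auto simp: \<sigma>_def)
  note reg = regular_common_face[OF assms(1) cf, folded \<rho>_def]
  have "m \<tau> \<noteq> 0" "m \<tau>' \<noteq> 0" "m \<rho> \<noteq> 0"
    using coface_pos[OF reg(1)] coface_pos[OF reg(2)] by auto
  then show "bm \<tau> \<tau>' \<noteq> 0"
    using minus_cofaces(1)[OF reg(1,2) cf(3)] by simp
  show "om \<tau> \<tau>' = - op \<tau> \<tau>'"
    unfolding minus_cofaces(2)[OF reg(1,2) cf(3)] plus_cofaces(2)[OF cf]
    using reg(3) theta_cases[OF cf(1)] theta_cases[OF cf(2)] theta_cases[OF reg(1)]
      theta_cases[OF reg(2)] by auto
qed

text \<open>With x = \<open>bm \<tau> \<tau>' - bp \<tau> \<tau>'\<close> one has |x| sgn(x) = x;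
  wherever \<open>bp \<tau> \<tau>'\<close> is nonzero, the opposite signs turn
  \<open>- bp \<tau> \<tau>' * om \<tau> \<tau>'\<close> into
  \<open>bp \<tau> \<tau>' * op \<tau> \<tau>'\<close>.\<close>

lemma b_H_o_H:
  assumes "\<tau> \<in> regular_simplices S"
  shows "b_H S m \<tau> \<tau>' * o_H S m d \<tau> \<tau>' = bm \<tau> \<tau>' * om \<tau> \<tau>' + bp \<tau> \<tau>' * op \<tau> \<tau>'"
proof -
  have "b_H S m \<tau> \<tau>' * o_H S m d \<tau> \<tau>' =
      (\<bar>bm \<tau> \<tau>' - bp \<tau> \<tau>'\<bar> * sgn (bm \<tau> \<tau>' - bp \<tau> \<tau>')) * om \<tau> \<tau>'"
    by (simp add: b_H_def o_H_def)
  also have "\<dots> = (bm \<tau> \<tau>' - bp \<tau> \<tau>') * om \<tau> \<tau>'"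
    by (simp only: abs_mult_sgn)
  also have "\<dots> = bm \<tau> \<tau>' * om \<tau> \<tau>' + bp \<tau> \<tau>' * op \<tau> \<tau>'"
    using regular_opposite_signs(2)[OF assms, of \<tau>']
    by (cases "bp \<tau> \<tau>' = 0") (simp_all add: algebra_simps)
  finally show ?thesis .
qed

lemma b_H_le: "b_H S m \<tau> \<tau>' \<le> bm \<tau> \<tau>' + bp \<tau> \<tau>'"
  using b_plus_nonneg[of \<tau> \<tau>'] b_minus_nonneg[of \<tau> \<tau>'] by (simp add: b_H_def)

lemma b_H_summable:
  assumes "\<tau> \<in> S"
  shows "b_H S m \<tau> summable_on S"
proof (rule summable_on_real_comparison)
  show "(\<lambda>\<tau>'. bm \<tau> \<tau>' + bp \<tau> \<tau>') summable_on S"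
    using assms by (intro summable_on_add b_plus_summable has_sum_imp_summable[OF has_sum_b_minus])
  show "\<bar>b_H S m \<tau> \<tau>'\<bar> \<le> bm \<tau> \<tau>' + bp \<tau> \<tau>'" for \<tau>'
    using b_H_le[of \<tau> \<tau>'] by (simp add: b_H_def)
qed

text \<open>The innermost sum in \<open>c_H\<close> has at most one term, since distinct simplices
  share at most one coface.\<close>

lemma b_plus_eq_infsum:
  assumes "\<tau>' \<noteq> \<tau>"
  shows "(\<Sum>\<^sub>\<infinity>\<sigma>\<in>cofaces S \<tau> \<inter> cofaces S \<tau>'. m \<sigma>) = bp \<tau> \<tau>'"
proof (cases "cofaces S \<tau> \<inter> cofaces S \<tau>' = {}")
  case True
  then have "bp \<tau> \<tau>' = 0"
    by (auto simp: b_plus_def)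
  with True show ?thesis
    by simp
next
  case False
  then obtain \<sigma> where \<sigma>: "coface S \<tau> \<sigma>" "coface S \<tau>' \<sigma>"
    by auto
  have "\<sigma>' = \<sigma>" if "coface S \<tau> \<sigma>'" "coface S \<tau>' \<sigma>'" for \<sigma>'
    using coface_Un_eq[OF \<sigma>] coface_Un_eq[OF that] assms by metis
  then have "cofaces S \<tau> \<inter> cofaces S \<tau>' = {\<sigma>}"
    using \<sigma> unfolding cofaces_def by blast
  then show ?thesis
    using plus_cofaces(1)[OF \<sigma> assms] by simp
qed

text \<open>The double sum in \<open>c_H\<close> runs over simplices sharing a face with \<tau>,
  whereas \<open>b_H\<close> may also see those sharing only a coface. At a regular \<tau> a common
  coface forces a common face, so the double sum is the whole edge weight.\<close>

lemma c_H_eq: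
  assumes "\<tau> \<in> regular_simplices S"
  shows "c_H S m \<tau> = ((\<Sum>\<rho>\<in>faces S \<tau>. (m \<tau>)\<^sup>2 / m \<rho>) + (\<Sum>\<^sub>\<infinity>\<sigma>\<in>cofaces S \<tau>. m \<sigma>))
    - (\<Sum>\<^sub>\<infinity>\<tau>'\<in>S. b_H S m \<tau> \<tau>')"
proof -
  have \<tau>: "\<tau> \<in> S"
    using assms by (simp add: regular_simplices_def)
  have "(b_H S m \<tau> has_sum
      (\<Sum>\<rho>\<in>faces S \<tau>. \<Sum>\<^sub>\<infinity>\<tau>'\<in>cofaces S \<rho> - {\<tau>}. b_H S m \<tau> \<tau>')) S"
  proof (rule has_sum_lower_neighbours[OF \<tau>])
    show "b_H S m \<tau> \<tau>' = 0" if "bm \<tau> \<tau>' = 0" for \<tau>'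
      using that regular_opposite_signs(1)[OF assms, of \<tau>'] by (auto simp: b_H_def)
    fix \<rho>
    have "b_H S m \<tau> summable_on cofaces S \<rho> - {\<tau>}"
      using b_H_summable[OF \<tau>] by (rule summable_on_subset_banach) (auto dest: coface_inD)
    then show "(b_H S m \<tau> has_sum (\<Sum>\<^sub>\<infinity>\<tau>'\<in>cofaces S \<rho> - {\<tau>}. b_H S m \<tau> \<tau>'))
        (cofaces S \<rho> - {\<tau>})"
      by simp
  qed
  then have "(\<Sum>\<^sub>\<infinity>\<tau>'\<in>S. b_H S m \<tau> \<tau>') =
      (\<Sum>\<rho>\<in>faces S \<tau>. \<Sum>\<^sub>\<infinity>\<tau>'\<in>cofaces S \<rho> - {\<tau>}. b_H S m \<tau> \<tau>')"
    by (rule infsumI)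
  also have "\<dots> = (\<Sum>\<rho>\<in>faces S \<tau>. \<Sum>\<^sub>\<infinity>\<tau>'\<in>cofaces S \<rho> - {\<tau>}.
      \<bar>m \<tau> * m \<tau>' / m \<rho> - (\<Sum>\<^sub>\<infinity>\<sigma>\<in>cofaces S \<tau> \<inter> cofaces S \<tau>'. m \<sigma>)\<bar>)"
    by (intro sum.cong infsum_cong refl) (simp add: b_H_def minus_cofaces b_plus_eq_infsum)
  finally show ?thesis
    by (simp add: c_H_def)
qed

lemma domain_H_H: "odom (H_plus S m d) \<inter> F1 S m \<subseteq> odom (H_H S m d)"
proof
  fix \<omega> assume \<omega>: "\<omega> \<in> odom (H_plus S m d) \<inter> F1 S m"
  have "(\<lambda>\<tau>'. b_H S m \<tau> \<tau>' * \<bar>\<omega> \<tau>'\<bar>) summable_on S" if "\<tau> \<in> S" for \<tau>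
  proof (rule summable_on_real_comparison)
    show "(\<lambda>\<tau>'. bm \<tau> \<tau>' * \<bar>\<omega> \<tau>'\<bar> + bp \<tau> \<tau>' * \<bar>\<omega> \<tau>'\<bar>) summable_on S"
      using \<omega> F1_iff[of \<omega>] that by (intro summable_on_add) (auto simp: domain_H_plus)
    show "\<bar>b_H S m \<tau> \<tau>' * \<bar>\<omega> \<tau>'\<bar>\<bar> \<le> bm \<tau> \<tau>' * \<bar>\<omega> \<tau>'\<bar> + bp \<tau> \<tau>' * \<bar>\<omega> \<tau>'\<bar>" for \<tau>'
      using mult_right_mono[OF b_H_le, of "\<bar>\<omega> \<tau>'\<bar>" \<tau> \<tau>']
      by (simp add: abs_mult b_H_def distrib_right)
  qed
  then show "\<omega> \<in> odom (H_H S m d)"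
    using \<omega> by (simp add: H_H_def schroedinger_op_def domain_H_plus)
qed

text \<open>The diagonal coefficients of the two compositions add up by \<open>c_H_eq\<close>, their
  off-diagonal sums by \<open>b_H_o_H\<close>.\<close>

lemma H_H_eq:
  assumes "\<omega> \<in> odom (H_plus S m d)" "\<omega> \<in> F1 S m" "\<tau> \<in> regular_simplices S"
  shows "oapp (H_H S m d) \<omega> \<tau> = bdry (d \<omega>) \<tau> + d (bdry \<omega>) \<tau>"
proof -
  have \<tau>: "\<tau> \<in> S"
    using assms(3) by (simp add: regular_simplices_def)
  have \<omega>: "\<omega> \<in> F S" and smp: "(\<lambda>\<tau>'. bp \<tau> \<tau>' * \<bar>\<omega> \<tau>'\<bar>) summable_on S"
    using assms(1) \<tau> by (auto simp: domain_H_plus)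
  have smm: "(\<lambda>\<tau>'. bm \<tau> \<tau>' * \<bar>\<omega> \<tau>'\<bar>) summable_on S"
    using F1_iff[OF \<omega>] assms(2) \<tau> by blast
  have "((\<lambda>\<tau>'. bm \<tau> \<tau>' * om \<tau> \<tau>' * \<omega> \<tau>' + bp \<tau> \<tau>' * op \<tau> \<tau>' * \<omega> \<tau>') has_sum
      (\<Sum>\<^sub>\<infinity>\<tau>'\<in>S. bm \<tau> \<tau>' * om \<tau> \<tau>' * \<omega> \<tau>') + (\<Sum>\<^sub>\<infinity>\<tau>'\<in>S. bp \<tau> \<tau>' * op \<tau> \<tau>' * \<omega> \<tau>')) S"
    by (intro has_sum_add has_sum_infsum summable_signed smp smm b_plus_nonneg b_minus_nonneg
        abs_o_plus_le abs_o_minus_le)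
  then have hs: "((\<lambda>\<tau>'. b_H S m \<tau> \<tau>' * o_H S m d \<tau> \<tau>' * \<omega> \<tau>') has_sum
      (\<Sum>\<^sub>\<infinity>\<tau>'\<in>S. bm \<tau> \<tau>' * om \<tau> \<tau>' * \<omega> \<tau>') + (\<Sum>\<^sub>\<infinity>\<tau>'\<in>S. bp \<tau> \<tau>' * op \<tau> \<tau>' * \<omega> \<tau>')) S"
    by (simp add: b_H_o_H[OF assms(3)] distrib_right)
  have "oapp (H_H S m d) \<omega> \<tau> = 1 / m \<tau> *
      (((\<Sum>\<rho>\<in>faces S \<tau>. (m \<tau>)\<^sup>2 / m \<rho>) + (\<Sum>\<^sub>\<infinity>\<sigma>\<in>cofaces S \<tau>. m \<sigma>)) * \<omega> \<tau>
        - (\<Sum>\<^sub>\<infinity>\<tau>'\<in>S. b_H S m \<tau> \<tau>' * o_H S m d \<tau> \<tau>' * \<omega> \<tau>'))"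
    unfolding H_H_def using hs
    by (intro schroedinger_apply \<tau> b_H_summable c_H_eq assms has_sum_imp_summable)
  also have "\<dots> = 1 / m \<tau> * ((\<Sum>\<^sub>\<infinity>\<sigma>\<in>cofaces S \<tau>. m \<sigma> * d \<omega> \<sigma> * \<theta> \<tau> \<sigma>) + m \<tau> * d (bdry \<omega>) \<tau>)"
    unfolding infsumI[OF hs] boundary_of_coboundary(2)[OF \<omega> \<tau> smp]
      coboundary_of_boundary[OF assms(2) \<tau>] by (simp add: algebra_simps)
  also have "\<dots> = bdry (d \<omega>) \<tau> + d (bdry \<omega>) \<tau>"
    using weight_pos[OF \<tau>] by (simp add: boundary_apply[OF \<tau>] algebra_simps add_divide_distrib)
  finally show ?thesis .
qed

section \<open>Green's formula\<close>

text \<open>Both pairings are iterated sums of one double series over the pairs \<tau> \<prec>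
  \<sigma>. Its summability is an assumption, because either \<alpha> or \<beta> will be the
  finitely supported function.\<close>

lemma green_formula:
  assumes "\<beta> \<in> F S"
    and "(\<lambda>(\<tau>, \<sigma>). \<beta> \<tau> * (m \<sigma> * \<alpha> \<sigma> * \<theta> \<tau> \<sigma>)) summable_on (SIGMA \<tau>:S. cofaces S \<tau>)"
  shows "pairable S m \<alpha> (d \<beta>)" "pairable S m (bdry \<alpha>) \<beta>"
    and "pairing S m \<alpha> (d \<beta>) = pairing S m (bdry \<alpha>) \<beta>"
proof -
  obtain x where x: "((\<lambda>(\<tau>, \<sigma>). \<beta> \<tau> * (m \<sigma> * \<alpha> \<sigma> * \<theta> \<tau> \<sigma>)) has_sum x) (SIGMA \<tau>:S. cofaces S \<tau>)"
    using assms(2) by (auto simp: summable_on_def)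
  also have "?this \<longleftrightarrow>
      ((\<lambda>(\<sigma>, \<tau>). \<beta> \<tau> * (m \<sigma> * \<alpha> \<sigma> * \<theta> \<tau> \<sigma>)) has_sum x) (SIGMA \<sigma>:S. faces S \<sigma>)"
    by (rule has_sum_reindex_bij_witness[where i = prod.swap and j = prod.swap])
      (auto dest: coface_inD)
  finally have y: "((\<lambda>(\<sigma>, \<tau>). \<beta> \<tau> * (m \<sigma> * \<alpha> \<sigma> * \<theta> \<tau> \<sigma>)) has_sum x) (SIGMA \<sigma>:S. faces S \<sigma>)" .
  have 1: "((\<lambda>\<tau>. m \<tau> * bdry \<alpha> \<tau> * \<beta> \<tau>) has_sum x) S"
  proof (rule has_sum_Sigma'[OF x])
    fix \<tau> assume \<tau>: "\<tau> \<in> S"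
    have "(\<Sum>\<^sub>\<infinity>\<sigma>\<in>cofaces S \<tau>. \<beta> \<tau> * (m \<sigma> * \<alpha> \<sigma> * \<theta> \<tau> \<sigma>)) = m \<tau> * bdry \<alpha> \<tau> * \<beta> \<tau>"
      using weight_pos[OF \<tau>] by (simp add: infsum_cmult_right' boundary_apply[OF \<tau>])
    then show "((\<lambda>\<sigma>. case (\<tau>, \<sigma>) of (\<tau>, \<sigma>) \<Rightarrow> \<beta> \<tau> * (m \<sigma> * \<alpha> \<sigma> * \<theta> \<tau> \<sigma>)) has_sum
        m \<tau> * bdry \<alpha> \<tau> * \<beta> \<tau>) (cofaces S \<tau>)"
      using has_sum_infsum[OF summable_on_SigmaD1[OF assms(2) \<tau>]] by simp
  qed
  have 2: "((\<lambda>\<sigma>. m \<sigma> * \<alpha> \<sigma> * d \<beta> \<sigma>) has_sum x) S"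
  proof (rule has_sum_Sigma'[OF y])
    fix \<sigma> assume \<sigma>: "\<sigma> \<in> S"
    then show "((\<lambda>\<tau>. case (\<sigma>, \<tau>) of (\<sigma>, \<tau>) \<Rightarrow> \<beta> \<tau> * (m \<sigma> * \<alpha> \<sigma> * \<theta> \<tau> \<sigma>)) has_sum
        m \<sigma> * \<alpha> \<sigma> * d \<beta> \<sigma>) (faces S \<sigma>)"
      using finite_faces[OF \<sigma>] assms(1)
      by (intro has_sum_finiteI) (auto simp: coboundary_apply sum_distrib_left mult_ac)
  qed
  show "pairable S m \<alpha> (d \<beta>)" "pairable S m (bdry \<alpha>) \<beta>"
    and "pairing S m \<alpha> (d \<beta>) = pairing S m (bdry \<alpha>) \<beta>"
    using 1 2 by (auto simp: pairable_def pairing_def summable_on_def dest: infsumI)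
qed

text \<open>Only finitely many \<tau> contribute, and for each of them the series over its cofaces
  converges absolutely by the definition of \<open>F1\<close>.\<close>

lemma green_summable_F1_Fc:
  assumes "\<alpha> \<in> F1 S m" "\<beta> \<in> Fc S"
  shows "(\<lambda>(\<tau>, \<sigma>). \<beta> \<tau> * (m \<sigma> * \<alpha> \<sigma> * \<theta> \<tau> \<sigma>)) summable_on (SIGMA \<tau>:S. cofaces S \<tau>)"
proof -
  have "(\<lambda>(\<tau>, \<sigma>). \<beta> \<tau> * (m \<sigma> * \<alpha> \<sigma> * \<theta> \<tau> \<sigma>)) abs_summable_on (SIGMA \<tau>:S. cofaces S \<tau>)"
    unfolding abs_summable_on_Sigma_iff
  proof (intro conjI ballI)
    fix \<tau> assume "\<tau> \<in> S"
    then have "(\<lambda>\<sigma>. \<beta> \<tau> * (m \<sigma> * \<alpha> \<sigma> * \<theta> \<tau> \<sigma>)) summable_on cofaces S \<tau>"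
      by (intro summable_on_cmult_right F1_signed_summable assms)
    then show "(\<lambda>\<sigma>. case (\<tau>, \<sigma>) of (\<tau>, \<sigma>) \<Rightarrow> \<beta> \<tau> * (m \<sigma> * \<alpha> \<sigma> * \<theta> \<tau> \<sigma>))
        abs_summable_on cofaces S \<tau>"
      unfolding case_prod_conv by (rule summable_on_iff_abs_summable_on_real[THEN iffD1])
  next
    have "finite {\<tau>. \<beta> \<tau> \<noteq> 0}"
      using assms(2) by (simp add: Fc_def)
    then show "(\<lambda>\<tau>. \<Sum>\<^sub>\<infinity>\<sigma>\<in>cofaces S \<tau>.
        norm (case (\<tau>, \<sigma>) of (\<tau>, \<sigma>) \<Rightarrow> \<beta> \<tau> * (m \<sigma> * \<alpha> \<sigma> * \<theta> \<tau> \<sigma>))) abs_summable_on S"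
      by (intro summable_on_finite_support) (erule rev_finite_subset, auto)
  qed
  then show ?thesis
    by (rule summable_on_iff_abs_summable_on_real[THEN iffD2])
qed

text \<open>The support of \<alpha> is finite and each simplex has finitely many faces, so only
  finitely many pairs contribute, whatever \<beta> is; it will be a boundary.\<close>

lemma green_summable_Fc:
  assumes "\<alpha> \<in> Fc S"
  shows "(\<lambda>(\<tau>, \<sigma>). \<beta> \<tau> * (m \<sigma> * \<alpha> \<sigma> * \<theta> \<tau> \<sigma>)) summable_on (SIGMA \<tau>:S. cofaces S \<tau>)"
proof (rule summable_on_finite_support, rule finite_subset)
  let ?A = "{\<sigma>\<in>S. \<alpha> \<sigma> \<noteq> 0}"
  show "finite (prod.swap ` (SIGMA \<sigma>:?A. faces S \<sigma>))"
    using assms by (intro finite_imageI finite_SigmaI finite_faces) (auto simp: Fc_def)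
  show "{x \<in> SIGMA \<tau>:S. cofaces S \<tau>. (case x of (\<tau>, \<sigma>) \<Rightarrow> \<beta> \<tau> * (m \<sigma> * \<alpha> \<sigma> * \<theta> \<tau> \<sigma>)) \<noteq> 0}
      \<subseteq> prod.swap ` (SIGMA \<sigma>:?A. faces S \<sigma>)"
    by (force dest: coface_inD)
qed

lemma pairable_Fc: "\<eta> \<in> Fc S \<Longrightarrow> pairable S m f \<eta>"
  unfolding pairable_def Fc_def
  by (intro summable_on_finite_support) (auto elim: rev_finite_subset)

lemma pairing_commute: "pairing S m f g = pairing S m g f"
  and pairable_commute: "pairable S m f g \<longleftrightarrow> pairable S m g f"
  by (simp_all add: pairing_def pairable_def mult_ac)

section \<open>Locally finite complexes\<close>

lemma locally_finite_domain_H_plus: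
  assumes "locally_finite S"
  shows "odom (H_plus S m d) = F S"
proof -
  have "(\<lambda>\<tau>'. bp \<tau> \<tau>' * \<bar>\<omega> \<tau>'\<bar>) summable_on S" if "\<tau> \<in> S" for \<tau> and \<omega> :: "'v set \<Rightarrow> real"
  proof (rule summable_on_finite_support, rule finite_subset)
    \<comment> \<open>The empty simplex may have infinitely many cofaces but has no upper
      neighbours: \<open>{} \<union> \<tau>'\<close> is \<tau>' itself, not a coface of it. The
      filter \<tau> \<noteq> {} makes the bound empty in this case.\<close>
    show "finite (\<Union>\<sigma>\<in>{\<sigma>\<in>cofaces S \<tau>. \<tau> \<noteq> {}}. faces S \<sigma>)"
      using assms that by (cases "\<tau> = {}")
        (auto simp: locally_finite_def cofaces_def intro!: finite_UN_I finite_faces dest: coface_inD)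
    have "\<tau> \<noteq> {}" if "bp \<tau> \<tau>' \<noteq> 0" for \<tau>'
      using b_plus_nonzeroD[OF that] by auto
    then show "{\<tau>'\<in>S. bp \<tau> \<tau>' * \<bar>\<omega> \<tau>'\<bar> \<noteq> 0} \<subseteq> (\<Union>\<sigma>\<in>{\<sigma>\<in>cofaces S \<tau>. \<tau> \<noteq> {}}. faces S \<sigma>)"
      using b_plus_nonzeroD[of \<tau>] by fastforce
  qed
  then show ?thesis
    by (auto simp: domain_H_plus)
qed

text \<open>Local finiteness says nothing about the empty simplex, hence the separate condition on
  its cofaces; it holds trivially if the empty simplex is not in \<open>S\<close>.\<close>

lemma finite_cofaces_F1:
  assumes "locally_finite S" "finite (cofaces S {})"
  shows "F1 S m = F S"
proof -
  have "finite (cofaces S \<tau>)" if "\<tau> \<in> S" for \<tau>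
    using assms that by (cases "\<tau> = {}") (auto simp: locally_finite_def)
  then show ?thesis
    by (auto simp: F1_def)
qed

end

text \<open>The Hodge identities are stated at regular simplices: at a nonregular vertex
  \<open>o_H\<close> vanishes, whereas \<partial>\<delta> still couples the vertex to its
  neighbours. On all of \<open>F S\<close>, \<delta>\<partial> requires finitely many vertices if
  the empty simplex is present, for otherwise \<omega>(v) = 1 / m(v) violates the domain condition
  of \<partial> there.\<close>

theorem theorem3p12:
  fixes V :: "'v set" and K S :: "'v set set" and m :: "'v set \<Rightarrow> real"
    and d :: "('v set \<Rightarrow> real) \<Rightarrow> ('v set \<Rightarrow> real)"
    and cob bd Hp Hm HH :: "'v operator" and Fp Fm :: "('v set \<Rightarrow> real) set"
  assumes "simplicial_complex V K"
    and "weight K m"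
    and "S = working_complex K m"
    and "locally_summable S m"
    and "coboundary S d"
    and "cob = coboundary_op S d" and "bd = boundary_op S m d"
    and "Hp = H_plus S m d" and "Hm = H_minus S m d" and "HH = H_H S m d"
    and "Fp = odom Hp" and "Fm = odom Hm"
  shows "Fp \<subseteq> odom (op_mult bd cob)
    \<and> Fm = odom (op_mult cob bd)
    \<and> Fp \<inter> Fm \<subseteq> odom (op_add (op_mult bd cob) (op_mult cob bd))
    \<and> agree_on Fp S Hp (op_mult bd cob)
    \<and> agree_on Fm S Hm (op_mult cob bd)
    \<and> agree_on (Fp \<inter> Fm) (regular_simplices S) HH (op_add (op_mult bd cob) (op_mult cob bd))
    \<and> (locally_finite S \<longrightarrow> agree_on (F S) S Hp (op_mult bd cob))
    \<and> (locally_finite S \<and> finite (cofaces S {}) \<longrightarrow>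
         agree_on (F S) S Hm (op_mult cob bd)
         \<and> agree_on (F S) (regular_simplices S) HH (op_add (op_mult bd cob) (op_mult cob bd)))
    \<and> (\<forall>\<eta>\<in>Fc S. \<forall>\<omega>\<in>Fp.
         pairable S m (oapp Hp \<omega>) \<eta> \<and> pairable S m (oapp cob \<omega>) (oapp cob \<eta>) \<and>
         pairing S m (oapp Hp \<omega>) \<eta> = pairing S m (oapp cob \<omega>) (oapp cob \<eta>))
    \<and> (\<forall>\<eta>\<in>Fc S. \<forall>\<omega>\<in>Fm.
         pairable S m (oapp Hm \<omega>) \<eta> \<and> pairable S m (oapp bd \<omega>) (oapp bd \<eta>) \<and>
         pairing S m (oapp Hm \<omega>) \<eta> = pairing S m (oapp bd \<omega>) (oapp bd \<eta>))
    \<and> (\<forall>\<eta>\<in>Fc S. (\<forall>\<tau>\<in>S - regular_simplices S. \<eta> \<tau> = 0) \<longrightarrow> (\<forall>\<omega>\<in>Fp \<inter> Fm.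
         pairable S m (oapp HH \<omega>) \<eta> \<and>
         pairing S m (oapp HH \<omega>) \<eta> =
           pairing S m (oapp cob \<omega>) (oapp cob \<eta>) + pairing S m (oapp bd \<omega>) (oapp bd \<eta>)))"
proof -
  \<comment> \<open>In both cases of \<open>working_complex\<close>, \<open>S\<close> and
    \<open>K\<close> differ at most by the empty simplex.\<close>
  have S: "S \<subseteq> K" "K - {{}} \<subseteq> S"
    using assms(3) by (auto simp: working_complex_def split: if_splits)
  interpret signed_complex S m d
  proof
    show "finite \<tau>" "0 < m \<tau>" if "\<tau> \<in> S" for \<tau>
      using that S(1) assms(1,2) by (auto simp: simplicial_complex_def weight_def)
    show "\<rho> \<in> S" if "\<sigma> \<in> S" "\<rho> \<subseteq> \<sigma>" "\<rho> \<noteq> {}" for \<sigma> \<rho>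
      using that S assms(1) unfolding simplicial_complex_def by blast
  qed fact+
  have cob: "odom cob = F S" "oapp cob = d" and bd: "odom bd = F1 S m" "oapp bd = bdry"
    using assms(6,7) by (simp_all add: coboundary_op_def boundary_op_def)
  have Fm: "Fm = F1 S m"
    using assms(9,12) by (simp add: domain_H_minus)
  have Fp_F: "Fp \<subseteq> F S" and F1_F: "F1 S m \<subseteq> F S"
    using assms(8,11) by (auto simp: domain_H_plus F1_def)
  \<comment> \<open>\<delta> is defined on all of \<open>F S\<close>, where every boundary lies, so
    the composition has the domain of \<partial>.\<close>
  have dbd: "odom (op_mult cob bd) = F1 S m"
    using boundary_in_F by (auto simp: op_mult_def cob bd)
  have bdd: "Fp \<subseteq> odom (op_mult bd cob)"
    using Fp_F H_plus_eq(1) assms(8,11) by (auto simp: op_mult_def cob bd)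
  have dom_add: "Fp \<inter> Fm \<subseteq> odom (op_add (op_mult bd cob) (op_mult cob bd))"
    using bdd by (auto simp: op_add_def dbd Fm)
  have plus: "agree_on Fp S Hp (op_mult bd cob)"
    unfolding agree_on_def using bdd H_plus_eq(2) assms(8,11)
    by (auto simp: oapp_op_mult cob bd)
  have minus: "agree_on Fm S Hm (op_mult cob bd)"
    unfolding agree_on_def Fm dbd assms(9) domain_H_minus using H_minus_eq
    by (auto simp: oapp_op_mult cob bd)
  have hodge: "agree_on (Fp \<inter> Fm) (regular_simplices S) HH (op_add (op_mult bd cob) (op_mult cob bd))"
    unfolding agree_on_def using dom_add domain_H_H H_H_eq assms(8,10,11) Fm
    by (auto simp: oapp_op_add oapp_op_mult cob bd)
  \<comment> \<open>Green's formula with \<alpha> = \<delta>\<omega> and \<beta> = \<eta>.\<close>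
  have green_plus: "pairable S m (d \<omega>) (d \<eta>)"
      "pairing S m (bdry (d \<omega>)) \<eta> = pairing S m (d \<omega>) (d \<eta>)"
      if "\<eta> \<in> Fc S" "\<omega> \<in> Fp" for \<eta> \<omega>
    using green_formula[OF _ green_summable_F1_Fc[OF H_plus_eq(1) that(1)]] that assms(8,11)
    by (auto simp: Fc_def)
  \<comment> \<open>Here the roles are exchanged, \<alpha> = \<eta> and \<beta> =
    \<partial>\<omega>, and the symmetry of the pairing restores the order.\<close>
  have green_minus: "pairable S m (bdry \<omega>) (bdry \<eta>)"
      "pairing S m (d (bdry \<omega>)) \<eta> = pairing S m (bdry \<omega>) (bdry \<eta>)"
      if "\<eta> \<in> Fc S" for \<eta> \<omega>
    using green_formula[OF boundary_in_F green_summable_Fc[OF that]]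
    by (simp_all add: pairing_commute[of _ \<eta>] pairing_commute[of "bdry \<eta>"] pairable_commute[of "bdry \<eta>"])
  have pairing_plus: "pairing S m (oapp Hp \<omega>) \<eta> = pairing S m (d \<omega>) (d \<eta>)"
    if "\<eta> \<in> Fc S" "\<omega> \<in> Fp" for \<eta> \<omega>
    unfolding green_plus(2)[OF that, symmetric] unfolding pairing_def
    using H_plus_eq(2)[of \<omega>] that assms(8,11) by (intro infsum_cong) simp
  have pairing_minus: "pairing S m (oapp Hm \<omega>) \<eta> = pairing S m (bdry \<omega>) (bdry \<eta>)"
    if "\<eta> \<in> Fc S" "\<omega> \<in> Fm" for \<eta> \<omega>
    unfolding green_minus(2)[OF that(1), symmetric] unfolding pairing_def
    using H_minus_eq[of \<omega>] that assms(9) Fm by (intro infsum_cong) simp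
  have pairing_hodge: "pairing S m (oapp HH \<omega>) \<eta> =
      pairing S m (d \<omega>) (d \<eta>) + pairing S m (bdry \<omega>) (bdry \<eta>)"
    if \<eta>: "\<eta> \<in> Fc S" "\<forall>\<tau>\<in>S - regular_simplices S. \<eta> \<tau> = 0" and \<omega>: "\<omega> \<in> Fp \<inter> Fm" for \<eta> \<omega>
  proof -
    have "pairing S m (oapp HH \<omega>) \<eta> =
        (\<Sum>\<^sub>\<infinity>\<tau>\<in>S. m \<tau> * bdry (d \<omega>) \<tau> * \<eta> \<tau> + m \<tau> * d (bdry \<omega>) \<tau> * \<eta> \<tau>)"
      unfolding pairing_def
    proof (rule infsum_cong)
      fix \<tau> assume "\<tau> \<in> S"
      \<comment> \<open>At a simplex that is not regular both sides vanish with \<eta>.\<close>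
      then show "m \<tau> * oapp HH \<omega> \<tau> * \<eta> \<tau> =
          m \<tau> * bdry (d \<omega>) \<tau> * \<eta> \<tau> + m \<tau> * d (bdry \<omega>) \<tau> * \<eta> \<tau>"
        using H_H_eq[of \<omega> \<tau>] \<eta>(2) \<omega> Fm assms(8,10,11)
        by (cases "\<tau> \<in> regular_simplices S") (simp_all add: algebra_simps)
    qed
    also have "\<dots> = pairing S m (bdry (d \<omega>)) \<eta> + pairing S m (d (bdry \<omega>)) \<eta>"
      unfolding pairing_def
      using pairable_Fc[OF \<eta>(1)] by (intro infsum_add) (simp_all add: pairable_def)
    finally show ?thesis
      using green_plus(2) green_minus(2) \<eta>(1) \<omega> by simp
  qed
  have lf: "locally_finite S \<Longrightarrow> Fp = F S"
    using locally_finite_domain_H_plus assms(8,11) by simp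
  have lf': "locally_finite S \<Longrightarrow> finite (cofaces S {}) \<Longrightarrow> Fm = F S"
    using finite_cofaces_F1 Fm by simp
  show ?thesis
  proof (intro conjI impI ballI)
    show "Fm = odom (op_mult cob bd)"
      by (simp add: Fm dbd)
    show "agree_on (F S) S Hp (op_mult bd cob)" if "locally_finite S"
      using plus lf[OF that] by simp
    show "agree_on (F S) S Hm (op_mult cob bd)" if "locally_finite S \<and> finite (cofaces S {})"
      using minus lf' that by simp
    show "agree_on (F S) (regular_simplices S) HH (op_add (op_mult bd cob) (op_mult cob bd))"
      if "locally_finite S \<and> finite (cofaces S {})"
      using hodge lf lf' that by simp
    show "pairable S m (oapp cob \<omega>) (oapp cob \<eta>)" if "\<eta> \<in> Fc S" "\<omega> \<in> Fp" for \<eta> \<omega>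
      using green_plus(1) that by (simp add: cob)
    show "pairing S m (oapp Hp \<omega>) \<eta> = pairing S m (oapp cob \<omega>) (oapp cob \<eta>)"
      if "\<eta> \<in> Fc S" "\<omega> \<in> Fp" for \<eta> \<omega>
      using pairing_plus that by (simp add: cob)
    show "pairable S m (oapp bd \<omega>) (oapp bd \<eta>)" if "\<eta> \<in> Fc S" "\<omega> \<in> Fm" for \<eta> \<omega>
      using green_minus(1) that by (simp add: bd)
    show "pairing S m (oapp Hm \<omega>) \<eta> = pairing S m (oapp bd \<omega>) (oapp bd \<eta>)"
      if "\<eta> \<in> Fc S" "\<omega> \<in> Fm" for \<eta> \<omega>
      using pairing_minus that by (simp add: bd)
    show "pairing S m (oapp HH \<omega>) \<eta> =
        pairing S m (oapp cob \<omega>) (oapp cob \<eta>) + pairing S m (oapp bd \<omega>) (oapp bd \<eta>)"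
      if "\<eta> \<in> Fc S" "\<forall>\<tau>\<in>S - regular_simplices S. \<eta> \<tau> = 0" "\<omega> \<in> Fp \<inter> Fm" for \<eta> \<omega>
      using pairing_hodge[OF that] by (simp add: cob bd)
  qed (use bdd dom_add plus minus hodge pairable_Fc in auto)
qed

end
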